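(* Let $E=(E,P,L,d)$ be an $f_{ms}$-BC and $e\in E$, and define $q:\mathbb{Z}B_{(E,e)}\rightarrow E$, $(w,n)\mapsto g^{n d(t(w))}\cdot t(w)$. Then $q$ is a covering of f-BCs. Let $\widetilde{E}$ be the universal cover of $E$ at $e$ and $p:\widetilde{E}\rightarrow E$, $\overline{v}\mapsto t(v)$. Then there exists a unique isomorphism of f-BCs $\phi:\mathbb{Z}B_{(E,e)}\rightarrow\widetilde{E}$ such that $q=p\phi$ and $\phi(((e||e),0))=\overline{(e||e)}$.
   Context: Let $G=\langle g\rangle$ be a fixed infinite cyclic group. A fractional Brauer configuration (f-BC) is a quadruple $E=(E,P,L,d)$, where $E$ is a $G$-set, $P$ and $L$ are two partitions of $E$ (write $P(e)$, $L(e)$ for the classes containing $e\in E$), and $d:E\to\mathbb{Z}_{>0}$ is a function, such that: (f1) $L(e)\subseteq P(e)$ and $P(e)$ is a finite set for each $e\in E$; (f2) if $L(e_1)=L(e_2)$, then $P(g\cdot e_1)=P(g\cdot e_2)$; (f3) if $e_1,e_2$ belong to the same $G$-orbit, then $d(e_1)=d(e_2)$; (f4) $P(e_1)=P(e_2)$ if and only if $P(g^{d(e_1)}\cdot e_1)=P(g^{d(e_2)}\cdot e_2)$; (f5) $L(e_1)=L(e_2)$ if and only if $L(g^{d(e_1)}\cdot e_1)=L(g^{d(e_2)}\cdot e_2)$; (f6) the sequence $L(g^{d(e)-1}\cdot e)\cdots L(g\cdot e)L(e)$ is not a proper subsequence (block of consecutive terms) of $L(g^{d(h)-1}\cdot h)\cdots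 L(g\cdot h)L(h)$ for all $e,h\in E$. An f-BC is of type MS (an $f_{ms}$-BC) if $L(e)=\{e\}$ for all $e\in E$. A morphism of f-BCs $f:(E,P,L,d)\to(E',P',L',d')$ is a $G$-equivariant map with $f(P(e))\subseteq P'(f(e))$, $f(L(e))\subseteq L'(f(e))$ and $d'(f(e))=d(e)$ for all $e\in E$. It is an isomorphism if it has an inverse morphism, and a covering if it induces bijections $P(e)\to P'(f(e))$ and $L(e)\to L'(f(e))$ for all $e\in E$. A walk of $E$ is a sequence $w=(e_n|\delta_n|e_{n-1})\cdots(e_2|\delta_2|e_1)(e_1|\delta_1|e_0)$ with $e_i\in E$, $\delta_i\in\{g,g^{-1},\tau\}$, such that $e_i=g\cdot e_{i-1}$ if $\delta_i=g$, $e_i=g^{-1}\cdot e_{i-1}$ if $\delta_i=g^{-1}$, and $P(e_i)=P(e_{i-1})$ if $\delta_i=\tau$. It is abbreviated $(e_n|\delta_n\cdots\delta_1|e_0)$; $s(w)=e_0$, $t(w)=e_n$; $(e||e)$ is the walk of length $0$ at $e$. The composition $uv$ is defined by concatenation when $t(v)=s(u)$. The homotopy relation $\sim$ is the smallest equivalence relation on walks such that: (h1) $(e|g^{-1}g|e)\sim(e|gg^{-1}|e)\sim(e|\tau|e)\sim(e||e)$; (h2) $(e_2|\tau|e_1)(e_1|\tau|e_0)\sim(e_2|\tau|e_0)$; (h3) $(g^{d(h)}\cdot h|\tau|g^{d(e)}\cdot e)(g^{d(e)}\cdot e|g^{d(e)}|e)\sim(g^{d(h)}\cdot h|g^{d(h)}|h)(h|\tau|e)$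 whenever $P(e)=P(h)$; (h4) $(g\cdot h|\tau|g\cdot e)(g\cdot e|g|e)\sim(g\cdot h|g|h)(h|\tau|e)$ whenever $L(e)=L(h)$; (h5) if $w_1\sim w_2$ then $uw_1\sim uw_2$ and $w_1v\sim w_2v$ whenever the compositions make sense. $\overline{w}$ denotes the homotopy class of $w$. The universal cover of $E$ at $e\in E$ is the f-BC $\widetilde{E}=(\widetilde{E},\widetilde{P},\widetilde{L},\widetilde{d})$, where $\widetilde{E}=\{\overline{w}\mid s(w)=e\}$, $g^n\cdot\overline{w}=\overline{(g^n\cdot t(w)|g^n|t(w))w}$, $\widetilde{P}(\overline{w})=\{\overline{(h|\tau|t(w))w}\mid h\in P(t(w))\}$, $\widetilde{L}(\overline{w})=\{\overline{(h|\tau|t(w))w}\mid h\in L(t(w))\}$, $\widetilde{d}(\overline{w})=d(t(w))$. Special walks: a walk of an $f_{ms}$-BC $E$ is special if it has the form $$(g^{i_k}\cdot e_k|g^{i_k}|e_k)(e_k|\tau|g^{i_{k-1}}\cdot e_{k-1})(g^{i_{k-1}}\cdot e_{k-1}|g^{i_{k-1}}|e_{k-1})\cdots(e_1|\tau|g^{i_0}\cdot e_0)(g^{i_0}\cdot e_0|g^{i_0}|e_0)$$ with $k\ge 0$, $0\le i_0<d(e_0)$, $0\le i_k<d(e_k)$, $0<i_l<d(e_l)$ for $1\le l\le k-1$, and $e_j\ne g^{i_{j-1}}\cdot e_{j-1}$ for $1\le j\le k$. It is written $w=g^{i_k}\tau g^{i_{k-1}}\tau\cdots\tau g^{i_1}\tau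 g^{i_0}$ (the trivial walk being $k=0$, $i_0=0$). The $f_{ms}$-BC $B_{(E,e)}=(B_{(E,e)},P',L',d')$: its set is the set of special walks of $E$ starting at $e$. For $w=g^{i_k}\tau\cdots\tau g^{i_0}$, $g\cdot w=g^{i_k+1}\tau g^{i_{k-1}}\tau\cdots\tau g^{i_0}$ if $i_k<d(t(w))-1$, and $g\cdot w=\tau g^{i_{k-1}}\tau\cdots\tau g^{i_0}$ (i.e. $i_k$ is replaced by $0$) if $i_k=d(t(w))-1$. The partition $P'$: $P'((e||e))=\{(e||e)\}\cup\{(h|\tau|e)\mid h\in P(e),h\neq e\}$; if $w$ has positive length and $i_k>0$, $P'(w)=\{w\}\cup\{(h|\tau|t(w))w\mid h\in P(t(w)),h\ne t(w)\}$; if $w$ has positive length and $i_k=0$, $P'(w)=P'(w')$ with $w'=g^{i_{k-1}}\tau\cdots\tau g^{i_0}$. $L'(w)=\{w\}$ and $d'(w)=d(t(w))$. The $f_{ms}$-BC $\mathbb{Z}B_{(E,e)}=(\mathbb{Z}B_{(E,e)},\widetilde{P},\widetilde{L},\widetilde{d})$: its set is $\{(w,n)\mid w\in B_{(E,e)},n\in\mathbb{Z}\}$; for $w=g^{i_k}\tau\cdots\tau g^{i_0}$, $g\cdot(w,n)=(g\cdot w,n)$ if $i_k<d(t(w))-1$ and $g\cdot(w,n)=(g\cdot w,n+1)$ if $i_k=d(t(w))-1$; $\widetilde{P}(w,n)=\{(w',n)\mid w'\in P'(w)\}$, $\widetilde{L}(w,n)=\{(w,n)\}$, $\widetilde{d}(w,n)=d(t(w))$.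 *)

theory Defs
  imports
    "HOL-Algebra.Group_Action"
    "HOL-Algebra.Elementary_Groups"
    "HOL-Library.Disjoint_Sets"
    "HOL-Library.Sublist"
begin

section \<open>Fractional Brauer configurations\<close>

text \<open>
  The infinite cyclic group $G = \langle g \rangle$ is \<^const>\<open>integer_group\<close> with generator
  $g = 1$, so that \<open>act E n x\<close> is $g^n \cdot x$.
\<close>

record 'a fbc = "'a partial_object" +
  act :: "int \<Rightarrow> 'a \<Rightarrow> 'a"
  Ppart :: "'a set set"
  Lpart :: "'a set set"
  deg :: "'a \<Rightarrow> nat"

definition block_of :: "'a set set \<Rightarrow> 'a \<Rightarrow> 'a set" where
  "block_of X x = (THE A. A \<in> X \<and> x \<in> A)"

abbreviation Pcls :: "('a, 'b) fbc_scheme \<Rightarrow> 'a \<Rightarrow> 'a set" where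
  "Pcls E \<equiv> block_of (Ppart E)"

abbreviation Lcls :: "('a, 'b) fbc_scheme \<Rightarrow> 'a \<Rightarrow> 'a set" where
  "Lcls E \<equiv> block_of (Lpart E)"

text \<open>The sequence $L(g^{d(x)-1} \cdot x) \cdots L(g \cdot x) L(x)$.\<close>

definition Lseq :: "('a, 'b) fbc_scheme \<Rightarrow> 'a \<Rightarrow> 'a set list" where
  "Lseq E x = map (\<lambda>i. Lcls E (act E (int i) x)) (rev [0..<deg E x])"

locale fBC = group_action integer_group "carrier E" "act E" for E +
  assumes P_partition: "partition_on (carrier E) (Ppart E)"
    and L_partition: "partition_on (carrier E) (Lpart E)"
    and deg_pos: "x \<in> carrier E \<Longrightarrow> deg E x > 0"
    and f1: "x \<in> carrier E \<Longrightarrow> Lcls E x \<subseteq> Pcls E x \<and> finite (Pcls E x)"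
    and f2: "\<lbrakk>x \<in> carrier E; y \<in> carrier E; Lcls E x = Lcls E y\<rbrakk>
      \<Longrightarrow> Pcls E (act E 1 x) = Pcls E (act E 1 y)"
    and f3: "\<lbrakk>x \<in> carrier E; y \<in> orbit integer_group (act E) x\<rbrakk> \<Longrightarrow> deg E x = deg E y"
    and f4: "\<lbrakk>x \<in> carrier E; y \<in> carrier E\<rbrakk> \<Longrightarrow> Pcls E x = Pcls E y
      \<longleftrightarrow> Pcls E (act E (int (deg E x)) x) = Pcls E (act E (int (deg E y)) y)"
    and f5: "\<lbrakk>x \<in> carrier E; y \<in> carrier E\<rbrakk> \<Longrightarrow> Lcls E x = Lcls E y
      \<longleftrightarrow> Lcls E (act E (int (deg E x)) x) = Lcls E (act E (int (deg E y)) y)"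
    and f6: "\<lbrakk>x \<in> carrier E; y \<in> carrier E\<rbrakk> \<Longrightarrow> \<not> strict_sublist (Lseq E x) (Lseq E y)"

locale fms_BC = fBC +
  assumes type_MS: "x \<in> carrier E \<Longrightarrow> Lcls E x = {x}"

definition fbc_morphism ::
  "('a, 'c) fbc_scheme \<Rightarrow> ('b, 'd) fbc_scheme \<Rightarrow> ('a \<Rightarrow> 'b) \<Rightarrow> bool" where
  "fbc_morphism E E' f \<longleftrightarrow> fBC E \<and> fBC E' \<and> f \<in> carrier E \<rightarrow> carrier E' \<and>
     (\<forall>n. \<forall>x\<in>carrier E. f (act E n x) = act E' n (f x)) \<and>
     (\<forall>x\<in>carrier E. f ` Pcls E x \<subseteq> Pcls E' (f x) \<and> f ` Lcls E x \<subseteq> Lcls E' (f x)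
        \<and> deg E' (f x) = deg E x)"

definition fbc_iso ::
  "('a, 'c) fbc_scheme \<Rightarrow> ('b, 'd) fbc_scheme \<Rightarrow> ('a \<Rightarrow> 'b) \<Rightarrow> bool" where
  "fbc_iso E E' f \<longleftrightarrow> fbc_morphism E E' f \<and>
     (\<exists>h. fbc_morphism E' E h \<and> (\<forall>x\<in>carrier E. h (f x) = x) \<and> (\<forall>y\<in>carrier E'. f (h y) = y))"

definition fbc_covering ::
  "('a, 'c) fbc_scheme \<Rightarrow> ('b, 'd) fbc_scheme \<Rightarrow> ('a \<Rightarrow> 'b) \<Rightarrow> bool" where
  "fbc_covering E E' f \<longleftrightarrow> fbc_morphism E E' f \<and>
     (\<forall>x\<in>carrier E. bij_betw f (Pcls E x) (Pcls E' (f x)) \<and> bij_betw f (Lcls E x) (Lcls E' (f x)))"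


section \<open>Walks and homotopy\<close>

datatype letter = Gen | GenInv | Tau

text \<open>\<open>Triv x\<close> is $(x||x)$, and \<open>Step y \<delta> w\<close> is the composition $(y|\delta|t(w))\,w$.\<close>

datatype 'a walk = Triv 'a | Step 'a letter "'a walk"

primrec src :: "'a walk \<Rightarrow> 'a" where
  "src (Triv x) = x"
| "src (Step y \<delta> w) = src w"

primrec tgt :: "'a walk \<Rightarrow> 'a" where
  "tgt (Triv x) = x"
| "tgt (Step y \<delta> w) = y"

primrec comp_walk :: "'a walk \<Rightarrow> 'a walk \<Rightarrow> 'a walk" (infixr \<open>\<cdot>\<^sub>w\<close> 75) where
  "Triv x \<cdot>\<^sub>w v = v"
| "Step y \<delta> u \<cdot>\<^sub>w v = Step y \<delta> (u \<cdot>\<^sub>w v)"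

primrec is_step :: "('a, 'b) fbc_scheme \<Rightarrow> letter \<Rightarrow> 'a \<Rightarrow> 'a \<Rightarrow> bool" where
  "is_step E Gen x y \<longleftrightarrow> y = act E 1 x"
| "is_step E GenInv x y \<longleftrightarrow> y = act E (-1) x"
| "is_step E Tau x y \<longleftrightarrow> Pcls E y = Pcls E x"

primrec is_walk :: "('a, 'b) fbc_scheme \<Rightarrow> 'a walk \<Rightarrow> bool" where
  "is_walk E (Triv x) \<longleftrightarrow> x \<in> carrier E"
| "is_walk E (Step y \<delta> w) \<longleftrightarrow> is_walk E w \<and> y \<in> carrier E \<and> is_step E \<delta> (tgt w) y"

primrec pos_walk :: "('a, 'b) fbc_scheme \<Rightarrow> nat \<Rightarrow> 'a \<Rightarrow> 'a walk" where
  "pos_walk E 0 x = Triv x"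
| "pos_walk E (Suc n) x = Step (act E (int (Suc n)) x) Gen (pos_walk E n x)"

primrec neg_walk :: "('a, 'b) fbc_scheme \<Rightarrow> nat \<Rightarrow> 'a \<Rightarrow> 'a walk" where
  "neg_walk E 0 x = Triv x"
| "neg_walk E (Suc n) x = Step (act E (- int (Suc n)) x) GenInv (neg_walk E n x)"

text \<open>The walk $(g^n \cdot x | g^n | x)$ of length $|n|$.\<close>

definition pow_walk :: "('a, 'b) fbc_scheme \<Rightarrow> int \<Rightarrow> 'a \<Rightarrow> 'a walk" where
  "pow_walk E n x = (if n \<ge> 0 then pos_walk E (nat n) x else neg_walk E (nat (- n)) x)"

inductive homotopic :: "('a, 'b) fbc_scheme \<Rightarrow> 'a walk \<Rightarrow> 'a walk \<Rightarrow> bool" for E where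
  refl: "is_walk E w \<Longrightarrow> homotopic E w w"
| sym: "homotopic E w v \<Longrightarrow> homotopic E v w"
| trans: "homotopic E u v \<Longrightarrow> homotopic E v w \<Longrightarrow> homotopic E u w"
| h1_inv_gen: "x \<in> carrier E \<Longrightarrow>
    homotopic E (Step x GenInv (Step (act E 1 x) Gen (Triv x))) (Triv x)"
| h1_gen_inv: "x \<in> carrier E \<Longrightarrow>
    homotopic E (Step x Gen (Step (act E (-1) x) GenInv (Triv x))) (Triv x)"
| h1_tau: "x \<in> carrier E \<Longrightarrow> homotopic E (Step x Tau (Triv x)) (Triv x)"
| h2: "\<lbrakk>x \<in> carrier E; y \<in> carrier E; z \<in> carrier E; Pcls E x = Pcls E y; Pcls E y = Pcls E z\<rbrakk> \<Longrightarrow>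
    homotopic E (Step z Tau (Step y Tau (Triv x))) (Step z Tau (Triv x))"
| h3: "\<lbrakk>x \<in> carrier E; y \<in> carrier E; Pcls E x = Pcls E y\<rbrakk> \<Longrightarrow>
    homotopic E
      (Step (act E (int (deg E y)) y) Tau (pow_walk E (int (deg E x)) x))
      (pow_walk E (int (deg E y)) y \<cdot>\<^sub>w Step y Tau (Triv x))"
| h4: "\<lbrakk>x \<in> carrier E; y \<in> carrier E; Lcls E x = Lcls E y\<rbrakk> \<Longrightarrow>
    homotopic E
      (Step (act E 1 y) Tau (Step (act E 1 x) Gen (Triv x)))
      (Step (act E 1 y) Gen (Step y Tau (Triv x)))"
| h5_left: "\<lbrakk>homotopic E w w'; is_walk E u; src u = tgt w; src u = tgt w'\<rbrakk> \<Longrightarrow>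
    homotopic E (u \<cdot>\<^sub>w w) (u \<cdot>\<^sub>w w')"
| h5_right: "\<lbrakk>homotopic E w w'; is_walk E v; src w = tgt v; src w' = tgt v\<rbrakk> \<Longrightarrow>
    homotopic E (w \<cdot>\<^sub>w v) (w' \<cdot>\<^sub>w v)"

definition hclass :: "('a, 'b) fbc_scheme \<Rightarrow> 'a walk \<Rightarrow> 'a walk set" where
  "hclass E w = {v. homotopic E w v}"


section \<open>The universal cover\<close>

text \<open>
  Functions on homotopy classes are written as unions over all representatives, respectively as the
  common value at all representatives; homotopic walks have the same source and target.
\<close>

definition class_tgt :: "'a walk set \<Rightarrow> 'a" where
  "class_tgt C = the_elem (tgt ` C)"

definition ucov_set :: "('a, 'b) fbc_scheme \<Rightarrow> 'a \<Rightarrow> 'a walk set set" where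
  "ucov_set E e = {hclass E w | w. is_walk E w \<and> src w = e}"

definition tau_classes :: "('a, 'b) fbc_scheme \<Rightarrow> ('a \<Rightarrow> 'a set) \<Rightarrow> 'a walk set \<Rightarrow> 'a walk set set" where
  "tau_classes E K C = {hclass E (Step h Tau w) | h w. w \<in> C \<and> h \<in> K (tgt w)}"

definition ucov :: "('a, 'b) fbc_scheme \<Rightarrow> 'a \<Rightarrow> 'a walk set fbc" where
  "ucov E e =
    \<lparr>carrier = ucov_set E e,
     act = (\<lambda>n. \<lambda>C\<in>ucov_set E e. \<Union>w\<in>C. hclass E (pow_walk E n (tgt w) \<cdot>\<^sub>w w)),
     Ppart = tau_classes E (Pcls E) ` ucov_set E e,
     Lpart = tau_classes E (Lcls E) ` ucov_set E e,
     deg = (\<lambda>C. deg E (class_tgt C))\<rparr>"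

definition ucov_proj :: "'a walk set \<Rightarrow> 'a" where
  "ucov_proj C = class_tgt C"


section \<open>Special walks\<close>

text \<open>
  \<open>special_form E x i k\<close> is the walk
  $(g^{i_k} \cdot x_k|g^{i_k}|x_k)(x_k|\tau|g^{i_{k-1}} \cdot x_{k-1}) \cdots
   (x_1|\tau|g^{i_0} \cdot x_0)(g^{i_0} \cdot x_0|g^{i_0}|x_0)$.
\<close>

primrec special_form ::
  "('a, 'b) fbc_scheme \<Rightarrow> (nat \<Rightarrow> 'a) \<Rightarrow> (nat \<Rightarrow> nat) \<Rightarrow> nat \<Rightarrow> 'a walk" where
  "special_form E x i 0 = pow_walk E (int (i 0)) (x 0)"
| "special_form E x i (Suc k) =
     pow_walk E (int (i (Suc k))) (x (Suc k)) \<cdot>\<^sub>w Step (x (Suc k)) Tau (special_form E x i k)"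

definition special :: "('a, 'b) fbc_scheme \<Rightarrow> 'a walk \<Rightarrow> bool" where
  "special E w \<longleftrightarrow> is_walk E w \<and>
     (\<exists>k x i. w = special_form E x i k \<and>
        i 0 < deg E (x 0) \<and> i k < deg E (x k) \<and>
        (\<forall>l. 1 \<le> l \<and> l < k \<longrightarrow> 0 < i l \<and> i l < deg E (x l)) \<and>
        (\<forall>j\<in>{1..k}. x j \<noteq> act E (int (i (j - 1))) (x (j - 1))))"

text \<open>
  For $w = g^{i_k} \tau g^{i_{k-1}} \tau \cdots \tau g^{i_0}$, \<open>last_exp w\<close> is $i_k$ and
  \<open>reset_exp w\<close> is $w$ with $i_k$ replaced by $0$.
\<close>

primrec last_exp :: "'a walk \<Rightarrow> nat" where
  "last_exp (Triv x) = 0"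
| "last_exp (Step y \<delta> w) = (if \<delta> = Gen then Suc (last_exp w) else 0)"

primrec reset_exp :: "'a walk \<Rightarrow> 'a walk" where
  "reset_exp (Triv x) = Triv x"
| "reset_exp (Step y \<delta> w) = (if \<delta> = Gen then reset_exp w else Step y \<delta> w)"


section \<open>The configurations $B_{(E,e)}$ and $\mathbb{Z}B_{(E,e)}$\<close>

text \<open>The action of the infinite cyclic group on \<open>S\<close> whose generator acts by the bijection \<open>f\<close>.\<close>

definition action_of :: "'a set \<Rightarrow> ('a \<Rightarrow> 'a) \<Rightarrow> int \<Rightarrow> 'a \<Rightarrow> 'a" where
  "action_of S f n = restrict f S [^]\<^bsub>BijGroup S\<^esub> n"

definition B_gen :: "('a, 'b) fbc_scheme \<Rightarrow> 'a walk \<Rightarrow> 'a walk" where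
  "B_gen E w = (if last_exp w < deg E (tgt w) - 1 then Step (act E 1 (tgt w)) Gen w else reset_exp w)"

text \<open>
  A special walk of positive length with $i_k = 0$ is \<open>Step y Tau w\<close>, where \<open>w\<close> is the walk $w'$
  with $P'(\tau w') = P'(w')$.
\<close>

primrec B_class :: "('a, 'b) fbc_scheme \<Rightarrow> 'a walk \<Rightarrow> 'a walk set" where
  "B_class E (Triv x) = {Triv x} \<union> {Step h Tau (Triv x) | h. h \<in> Pcls E x \<and> h \<noteq> x}"
| "B_class E (Step y \<delta> w) =
     (if \<delta> = Tau then B_class E w
      else {Step y \<delta> w} \<union> {Step h Tau (Step y \<delta> w) | h. h \<in> Pcls E y \<and> h \<noteq> y})"

definition B_set :: "('a, 'b) fbc_scheme \<Rightarrow> 'a \<Rightarrow> 'a walk set" where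
  "B_set E e = {w. special E w \<and> src w = e}"

definition B_conf :: "('a, 'b) fbc_scheme \<Rightarrow> 'a \<Rightarrow> 'a walk fbc" where
  "B_conf E e =
    \<lparr>carrier = B_set E e,
     act = action_of (B_set E e) (B_gen E),
     Ppart = B_class E ` B_set E e,
     Lpart = (\<lambda>w. {w}) ` B_set E e,
     deg = (\<lambda>w. deg E (tgt w))\<rparr>"

definition ZB_gen :: "('a, 'b) fbc_scheme \<Rightarrow> 'a \<Rightarrow> 'a walk \<times> int \<Rightarrow> 'a walk \<times> int" where
  "ZB_gen E e = (\<lambda>(w, n).
     (act (B_conf E e) 1 w, if last_exp w < deg E (tgt w) - 1 then n else n + 1))"

definition ZB_conf :: "('a, 'b) fbc_scheme \<Rightarrow> 'a \<Rightarrow> ('a walk \<times> int) fbc" where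
  "ZB_conf E e =
    \<lparr>carrier = carrier (B_conf E e) \<times> UNIV,
     act = action_of (carrier (B_conf E e) \<times> UNIV) (ZB_gen E e),
     Ppart = (\<lambda>(w, n). Pcls (B_conf E e) w \<times> {n}) ` (carrier (B_conf E e) \<times> UNIV),
     Lpart = (\<lambda>x. {x}) ` (carrier (B_conf E e) \<times> UNIV),
     deg = (\<lambda>(w, n). deg E (tgt w))\<rparr>"

definition ZB_proj :: "('a, 'b) fbc_scheme \<Rightarrow> 'a walk \<times> int \<Rightarrow> 'a" where
  "ZB_proj E = (\<lambda>(w, n). act E (n * int (deg E (tgt w))) (tgt w))"

end

theory Submission
  imports Defs
begin

text \<open>
  Coverings of f-BCs have unique lifting of walks, and the end point of the lift is a homotopy
  invariant: the relations (h1) and (h2) lift trivially, (h3) lifts by axiom (f4) and (h4) by axiom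
  (f2) upstairs. Once $q$ is known to be a covering, sending $\overline{v}$ to the end point of the
  lift of $v$ at $((e||e),0)$ inverts
  $\phi(w,n) = \overline{(g^{nd(t(w))} \cdot t(w)|g^{nd(t(w))}|t(w))\,w}$. So no normal form theorem
  for walks up to homotopy is needed, and the axioms for the universal cover are transported along
  $\phi$. Any morphism over $E$ with the prescribed value at $((e||e),0)$ maps the end point of the
  lift of $v$ to $\overline{v}$, which gives uniqueness.
\<close>

section \<open>Actions of the infinite cyclic group\<close>

text \<open>The map x -> g^{d(x)} x is a Nakayama automorphism: by (f4) it permutes the P-classes,
  and by (h3) it slides past a tau step. Hence full turns g^d can be pushed to the end of a walk,
  and the integer in (w, n) counts them; this is the origin of the exponent n d(t(w)) in q. The
  obstacle is to tell homotopy classes apart. Lifting turns this into a computation: a special walk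
  w lifts at the base point to (w, 0), and g^{n d} moves that to (w, n), so distinct pairs give
  non-homotopic walks. A circle has to be avoided, since the axioms of the universal cover come from
  the isomorphism. Lifting uses only the covering q, whose axioms are checked on explicit walks, and
  \<open>map_lift\<close> is phrased with \<open>act\<close> and \<open>tau_classes\<close> instead
  of morphisms: it is applied to the explicit map while \<open>ucov E e\<close> is not yet known to
  be an f-BC, and later to an arbitrary competing morphism. As HOL functions are total, uniqueness
  is read among maps that are \<open>extensional\<close> on the carrier.\<close>

lemma int_action_0:
  assumes "group_action integer_group S \<alpha>" "x \<in> S" shows "\<alpha> 0 x = x"
  using group_action.id_eq_one[OF assms(1)] assms(2) by (simp add: fun_eq_iff) metis

lemma int_action_closed:
  assumes "group_action integer_group S \<alpha>" "x \<in> S" shows "\<alpha> n x \<in> S"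
  using group_action.element_image[OF assms(1) _ assms(2)] by simp

lemma int_action_add:
  assumes "group_action integer_group S \<alpha>" "x \<in> S" shows "\<alpha> (m + n) x = \<alpha> m (\<alpha> n x)"
  using group_action.composition_rule[OF assms(1,2)] by simp

text \<open>Reduces equivariance to the generator, the only element whose action on special walks is
  given explicitly. Going down, the hypothesis for 1 is used at \<open>\<alpha> (n - 1) x\<close>
  and then cancelled by acting with -1.\<close>

lemma int_action_equivariant:
  assumes \<alpha>: "group_action integer_group S \<alpha>" and \<beta>: "group_action integer_group T \<beta>"
    and f: "\<And>x. x \<in> S \<Longrightarrow> f x \<in> T" "\<And>x. x \<in> S \<Longrightarrow> f (\<alpha> 1 x) = \<beta> 1 (f x)" and x: "x \<in> S"
  shows "f (\<alpha> n x) = \<beta> n (f x)"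
proof (induction n rule: int_induct[where k = 0])
  case base
  then show ?case using int_action_0[OF \<alpha> x] int_action_0[OF \<beta>] f(1) x by simp
next
  case (step1 n)
  then show ?case
    using int_action_add[OF \<alpha> x, of 1 n] int_action_add[OF \<beta> f(1)[OF x], of 1 n]
      f(2)[OF int_action_closed[OF \<alpha> x]] by (simp add: add.commute)
next
  case (step2 n)
  have "\<beta> n (f x) = \<beta> 1 (f (\<alpha> (n - 1) x))"
    using int_action_add[OF \<alpha> x, of 1 "n - 1"] step2(2) f(2)[OF int_action_closed[OF \<alpha> x, of "n - 1"]] by simp
  then have "\<beta> (-1) (\<beta> n (f x)) = \<beta> (-1 + 1) (f (\<alpha> (n - 1) x))"
    using int_action_add[OF \<beta>, of "f (\<alpha> (n - 1) x)" "-1" 1] f(1) int_action_closed[OF \<alpha> x] by simp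
  then show ?case
    using int_action_add[OF \<beta> f(1)[OF x], of "-1" n] int_action_0[OF \<beta> f(1)[OF int_action_closed[OF \<alpha> x, of "n - 1"]]]
    by simp
qed

text \<open>The elements of \<open>BijGroup S\<close> are extensional bijections, hence the
  condition \<open>ext\<close>; the inverse of \<open>\<alpha> n\<close> is
  \<open>\<alpha> (-n)\<close>.\<close>

lemma int_group_actionI:
  assumes ext: "\<And>n. \<alpha> n \<in> extensional S" and closed: "\<And>n x. x \<in> S \<Longrightarrow> \<alpha> n x \<in> S"
    and zero: "\<And>x. x \<in> S \<Longrightarrow> \<alpha> 0 x = x"
    and add: "\<And>m n x. x \<in> S \<Longrightarrow> \<alpha> (m + n) x = \<alpha> m (\<alpha> n x)"
  shows "group_action integer_group S \<alpha>"
proof -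
  have bij: "\<alpha> n \<in> Bij S" for n
    unfolding Bij_def using ext closed zero add[of _ n "-n"] add[of _ "-n" n]
    by (auto intro!: bij_betw_byWitness[where f' = "\<alpha> (-n)"])
  have "\<alpha> (m + n) = compose S (\<alpha> m) (\<alpha> n)" for m n
    using ext add by (intro extensionalityI[of _ S]) (auto simp: compose_def)
  then show ?thesis
    unfolding group_action_def group_hom_def group_hom_axioms_def
    using bij group_BijGroup by (auto simp: hom_def BijGroup_def)
qed

lemma group_action_action_of:
  assumes "bij_betw f S S" shows "group_action integer_group S (action_of S f)"
proof -
  interpret B: group "BijGroup S" by (rule group_BijGroup)
  have "restrict f S \<in> carrier (BijGroup S)"
    using assms by (simp add: BijGroup_def Bij_def)
  then show ?thesis
    unfolding action_of_def group_action_def group_hom_def group_hom_axioms_def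
    using B.hom_integer_group_pow B.is_group by auto
qed

lemma action_of_1:
  assumes "bij_betw f S S" "x \<in> S" shows "action_of S f 1 x = f x"
proof -
  interpret B: group "BijGroup S" by (rule group_BijGroup)
  have "restrict f S \<in> carrier (BijGroup S)"
    using assms by (simp add: BijGroup_def Bij_def)
  then show ?thesis using assms(2) by (simp add: action_of_def)
qed

section \<open>Configurations and their morphisms\<close>

lemma block_of_eq:
  assumes "partition_on S X" "A \<in> X" "x \<in> A" shows "block_of X x = A"
  unfolding block_of_def
  using assms unfolding partition_on_def pairwise_def disjnt_iff by (intro the_equality) blast+

text \<open>Both partitions of special walks have this form: the fibres of \<open>stem\<close> for
  B, those of \<open>map_prod stem id\<close> for ZB.\<close>

lemma partition_on_fibres:
  assumes "\<And>x. x \<in> S \<Longrightarrow> K x = {y \<in> S. r y = r x}"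
  shows "partition_on S (K ` S)" and "x \<in> S \<Longrightarrow> block_of (K ` S) x = K x"
proof -
  show *: "partition_on S (K ` S)"
    using assms by (auto intro!: partition_onI simp: disjnt_iff)
  show "x \<in> S \<Longrightarrow> block_of (K ` S) x = K x"
    using assms by (intro block_of_eq[OF *]) auto
qed

text \<open>With singleton L-classes, (f2) is trivial, (f5) says that x -> g^{d(x)} x is injective,
  and (f6) is automatic, so only the conditions on P and d remain. Serves both ZB and the universal
  cover.\<close>

lemma fms_BC_intro:
  fixes X :: "('a, 'b) fbc_scheme"
  assumes action: "group_action integer_group (carrier X) (act X)"
    and P: "partition_on (carrier X) (Ppart X)"
    and L: "Lpart X = (\<lambda>x. {x}) ` carrier X"
    and fin: "\<And>x. x \<in> carrier X \<Longrightarrow> finite (Pcls X x)"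
    and deg: "\<And>x. x \<in> carrier X \<Longrightarrow> deg X x > 0" "\<And>n x. x \<in> carrier X \<Longrightarrow> deg X (act X n x) = deg X x"
    and f4: "\<And>x y. \<lbrakk>x \<in> carrier X; y \<in> carrier X\<rbrakk> \<Longrightarrow> Pcls X x = Pcls X y
      \<longleftrightarrow> Pcls X (act X (int (deg X x)) x) = Pcls X (act X (int (deg X y)) y)"
  shows "fms_BC X"
proof -
  have Lp: "partition_on (carrier X) (Lpart X)"
    unfolding L by (rule partition_on_singletons)
  have Lc: "Lcls X x = {x}" if "x \<in> carrier X" for x
    using that by (intro block_of_eq[OF Lp]) (auto simp: L)
  note cl = int_action_closed[OF action]
  \<comment> \<open>The nontrivial half of (f5): degrees are constant on orbits, so equal images
    force equal degrees, and acting with the negative degree cancels.\<close>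
  have inj: "x = y" if "x \<in> carrier X" "y \<in> carrier X"
    "act X (int (deg X x)) x = act X (int (deg X y)) y" for x y
  proof -
    have "deg X x = deg X y" using deg(2) that by metis
    then show ?thesis
      using int_action_add[OF action, of _ "- int (deg X x)" "int (deg X x)"]
        int_action_0[OF action] that by (metis add.left_inverse)
  qed
  have Lsub: "Lcls X x \<subseteq> Pcls X x" if "x \<in> carrier X" for x
  proof -
    have "x \<in> \<Union> (Ppart X)" using partition_onD1[OF P] that by simp
    then obtain A where "A \<in> Ppart X" "x \<in> A" by blast
    then show ?thesis using block_of_eq[OF P] Lc[OF that] by auto
  qed
  \<comment> \<open>An entry of one sequence that occurs in the other one puts both elements into one orbit,
    so that the two sequences have the same length.\<close>
  have f6: "\<not> strict_sublist (Lseq X x) (Lseq X y)" if xy: "x \<in> carrier X" "y \<in> carrier X" for x y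
  proof
    assume sl: "strict_sublist (Lseq X x) (Lseq X y)"
    have "Lcls X (act X (int 0) x) \<in> set (Lseq X x)"
      using deg(1)[OF xy(1)] unfolding Lseq_def set_map by (intro imageI) simp
    then have "{x} \<in> set (Lseq X x)" using Lc[OF xy(1)] int_action_0[OF action xy(1)] by simp
    then have "{x} \<in> set (Lseq X y)"
      using sl set_mono_sublist unfolding strict_sublist_def by blast
    then obtain i where "x = act X (int i) y"
      using Lc cl xy(2) unfolding Lseq_def by auto
    then have "length (Lseq X x) = length (Lseq X y)"
      using deg(2) xy(2) by (simp add: Lseq_def)
    then show False using sl unfolding strict_sublist_def sublist_def by auto
  qed
  show ?thesis
    apply (intro fms_BC.intro fBC.intro fBC_axioms.intro fms_BC_axioms.intro action P Lp deg(1) f4 f6)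
    using Lc Lsub fin cl deg(2) inj by (auto simp: orbit_def)
qed

context fBC
begin

lemma action: "group_action integer_group (carrier E) (act E)" ..

lemmas act_0 [simp] = int_action_0[OF action]
lemmas act_closed [simp] = int_action_closed[OF action]
lemmas act_add = int_action_add[OF action]

lemma act_act [simp]: "x \<in> carrier E \<Longrightarrow> act E m (act E n x) = act E (m + n) x"
  by (simp add: act_add)

lemma deg_act [simp]: "x \<in> carrier E \<Longrightarrow> deg E (act E n x) = deg E x"
  using f3[of x "act E n x"] by (force simp: orbit_def)

lemma P_block: "x \<in> carrier E \<Longrightarrow> Pcls E x \<in> Ppart E \<and> x \<in> Pcls E x"
  using partition_onD1[OF P_partition] block_of_eq[OF P_partition] by (metis UnionE)

lemma P_self [simp]: "x \<in> carrier E \<Longrightarrow> x \<in> Pcls E x"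
  using P_block by blast

lemma mem_P_iff: "x \<in> carrier E \<Longrightarrow> y \<in> Pcls E x \<longleftrightarrow> y \<in> carrier E \<and> Pcls E y = Pcls E x"
  using P_block[of x] P_block[of y] block_of_eq[OF P_partition] partition_onD1[OF P_partition]
  by blast

lemma L_block: "x \<in> carrier E \<Longrightarrow> Lcls E x \<in> Lpart E \<and> x \<in> Lcls E x"
  using partition_onD1[OF L_partition] block_of_eq[OF L_partition] by (metis UnionE)

lemma mem_L_iff: "x \<in> carrier E \<Longrightarrow> y \<in> Lcls E x \<longleftrightarrow> y \<in> carrier E \<and> Lcls E y = Lcls E x"
  using L_block[of x] L_block[of y] block_of_eq[OF L_partition] partition_onD1[OF L_partition]
  by blast

lemma Ppart_eq: "Ppart E = Pcls E ` carrier E"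
proof
  show "Ppart E \<subseteq> Pcls E ` carrier E"
  proof
    fix A assume A: "A \<in> Ppart E"
    then obtain x where "x \<in> A" using partition_onD3[OF P_partition] by (metis ex_in_conv)
    then show "A \<in> Pcls E ` carrier E"
      using A block_of_eq[OF P_partition A] partition_onD1[OF P_partition] by blast
  qed
  show "Pcls E ` carrier E \<subseteq> Ppart E" using P_block by blast
qed

text \<open>(f4) is an equivalence, so it can be iterated in both directions; (f3) identifies the
  n-th iterate of x -> g^{d(x)} x with the action of n d(x).\<close>

lemma P_nakayama:
  assumes "x \<in> carrier E" "y \<in> carrier E" "Pcls E x = Pcls E y"
  shows "Pcls E (act E (n * int (deg E x)) x) = Pcls E (act E (n * int (deg E y)) y)"
proof (induction n rule: int_induct[where k = 0])
  case base
  then show ?case using assms by simp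
next
  case (step1 n)
  then show ?case
    using f4[of "act E (n * int (deg E x)) x" "act E (n * int (deg E y)) y"] assms
    by (simp add: algebra_simps)
next
  case (step2 n)
  then show ?case
    using f4[of "act E ((n - 1) * int (deg E x)) x" "act E ((n - 1) * int (deg E y)) y"] assms
    by (simp add: algebra_simps)
qed

end

text \<open>Asking for equality of image and class, not just inclusion, makes the inverse map a
  morphism as well.\<close>

lemma fbc_isoI:
  assumes X: "fBC X" and Y: "fBC Y" and bij: "bij_betw f (carrier X) (carrier Y)"
    and act: "\<And>n x. x \<in> carrier X \<Longrightarrow> f (act X n x) = act Y n (f x)"
    and P: "\<And>x. x \<in> carrier X \<Longrightarrow> f ` Pcls X x = Pcls Y (f x)"
    and L: "\<And>x. x \<in> carrier X \<Longrightarrow> f ` Lcls X x = Lcls Y (f x)"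
    and deg: "\<And>x. x \<in> carrier X \<Longrightarrow> deg Y (f x) = deg X x"
  shows "fbc_iso X Y f"
proof -
  interpret X: fBC X by fact
  interpret Y: fBC Y by fact
  define h where "h = inv_into (carrier X) f"
  have fX: "f x \<in> carrier Y" if "x \<in> carrier X" for x
    using bij that by (auto dest: bij_betwE)
  have hf: "h (f x) = x" if "x \<in> carrier X" for x
    using bij that by (simp add: h_def bij_betw_inv_into_left)
  have hY: "h y \<in> carrier X" "f (h y) = y" if "y \<in> carrier Y" for y
    using bij that by (auto simp: h_def bij_betw_inv_into_right bij_betw_def inv_into_into)
  have img: "h ` f ` A = A" if "A \<subseteq> carrier X" for A
    using that hf by (force simp: image_image)
  have sub: "Pcls X x \<subseteq> carrier X" "Lcls X x \<subseteq> carrier X" if "x \<in> carrier X" for x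
    using that X.mem_P_iff X.mem_L_iff by blast+
  have "fbc_morphism X Y f"
    using X Y fX act P L deg unfolding fbc_morphism_def by simp
  moreover have "fbc_morphism Y X h"
    unfolding fbc_morphism_def
  proof (intro conjI ballI allI X Y)
    show "h \<in> carrier Y \<rightarrow> carrier X" using hY by auto
    fix n y assume y: "y \<in> carrier Y"
    show "h (act Y n y) = act X n (h y)"
      using act[of "h y" n] hY[OF y] hf[of "act X n (h y)"] by simp
    show "h ` Pcls Y y \<subseteq> Pcls X (h y)"
      using P[of "h y"] img[of "Pcls X (h y)"] sub[of "h y"] hY[OF y] by simp
    show "h ` Lcls Y y \<subseteq> Lcls X (h y)"
      using L[of "h y"] img[of "Lcls X (h y)"] sub[of "h y"] hY[OF y] by simp
    show "deg X (h y) = deg Y y" using deg hY[OF y] by metis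
  qed
  ultimately show ?thesis unfolding fbc_iso_def using hf hY by blast
qed

section \<open>Homotopy of walks\<close>

declare homotopic.trans [trans]

lemma src_comp [simp]: "src (u \<cdot>\<^sub>w v) = src v"
  by (induction u) auto

lemma tgt_comp: "src u = tgt v \<Longrightarrow> tgt (u \<cdot>\<^sub>w v) = tgt u"
  by (cases u) auto

lemma comp_assoc: "(u \<cdot>\<^sub>w v) \<cdot>\<^sub>w w = u \<cdot>\<^sub>w v \<cdot>\<^sub>w w"
  by (induction u) auto

lemma comp_Triv: "src u = x \<Longrightarrow> u \<cdot>\<^sub>w Triv x = u"
  by (induction u) auto

context fBC
begin

lemma walk_src [simp]: "is_walk E w \<Longrightarrow> src w \<in> carrier E"
  by (induction w) auto

lemma walk_tgt [simp]: "is_walk E w \<Longrightarrow> tgt w \<in> carrier E"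
  by (cases w) auto

lemma walk_comp: "\<lbrakk>is_walk E u; is_walk E v; src u = tgt v\<rbrakk> \<Longrightarrow> is_walk E (u \<cdot>\<^sub>w v)"
  by (induction u) (auto simp: tgt_comp)

lemma src_pow [simp]: "src (pow_walk E n x) = x"
proof -
  have "src (pos_walk E k x) = x" "src (neg_walk E k x) = x" for k by (induction k) auto
  then show ?thesis by (simp add: pow_walk_def)
qed

lemma tgt_pos: "x \<in> carrier E \<Longrightarrow> tgt (pos_walk E k x) = act E (int k) x"
  by (cases k) auto

lemma tgt_neg: "x \<in> carrier E \<Longrightarrow> tgt (neg_walk E k x) = act E (- int k) x"
  by (cases k) auto

lemma tgt_pow [simp]: "x \<in> carrier E \<Longrightarrow> tgt (pow_walk E n x) = act E n x"
  by (auto simp: pow_walk_def tgt_pos tgt_neg)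

lemma walk_pow [simp]:
  assumes "x \<in> carrier E" shows "is_walk E (pow_walk E n x)"
proof -
  have "is_walk E (pos_walk E k x)" "is_walk E (neg_walk E k x)" for k
    using assms by (induction k) (auto simp: tgt_pos tgt_neg)
  then show ?thesis by (simp add: pow_walk_def)
qed

text \<open>Makes source and target well defined on classes. Only (h3) and (h4) need axioms: their
  closing tau steps are legal by (f4) and (f2), and (f1) allows a tau step between L-equivalent
  elements.\<close>

lemma homotopic_ends:
  assumes "homotopic E v w"
  shows "is_walk E v \<and> is_walk E w \<and> src v = src w \<and> tgt v = tgt w"
  using assms
proof (induction rule: homotopic.induct)
  case (h3 x y)
  then show ?case using P_nakayama[of x y 1] by (auto simp: comp_Triv tgt_comp intro!: walk_comp)
next
  case (h4 x y)
  then show ?case using f2[of x y] f1[of x] mem_L_iff[of x y] mem_P_iff[of x y] by auto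
next
  case (h5_left w w' u)
  then show ?case by (auto simp: tgt_comp intro!: walk_comp)
next
  case (h5_right w w' v)
  then show ?case by (auto simp: tgt_comp intro!: walk_comp)
qed auto

text \<open>The walk condition excludes the degenerate case of two non-walks, which share the empty
  class.\<close>

lemma hclass_eq_iff: "is_walk E v \<Longrightarrow> hclass E v = hclass E w \<longleftrightarrow> homotopic E v w"
  unfolding hclass_def set_eq_iff mem_Collect_eq
  by (meson homotopic.refl homotopic.sym homotopic.trans)

lemma class_tgt_hclass [simp]:
  assumes "is_walk E w" shows "class_tgt (hclass E w) = tgt w"
proof -
  have "tgt ` hclass E w = {tgt w}"
    using assms homotopic_ends homotopic.refl unfolding hclass_def by fastforce
  then show ?thesis by (simp add: class_tgt_def)
qed

lemma homotopic_comp: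
  assumes "homotopic E u u'" "homotopic E v v'" "src u = tgt v"
  shows "homotopic E (u \<cdot>\<^sub>w v) (u' \<cdot>\<^sub>w v')"
  using homotopic_ends[OF assms(1)] homotopic_ends[OF assms(2)] assms(3)
  by (intro homotopic.trans[OF homotopic.h5_right[OF assms(1)] homotopic.h5_left[OF assms(2)]]) auto

lemma homotopic_Step:
  assumes "homotopic E v w" "y \<in> carrier E" "is_step E \<delta> (tgt v) y"
  shows "homotopic E (Step y \<delta> v) (Step y \<delta> w)"
  using homotopic.h5_left[OF assms(1), of "Step y \<delta> (Triv (tgt v))"] homotopic_ends[OF assms(1)] assms
  by auto

lemma homotopic_inv_gen:
  assumes "is_walk E w" "x = act E 1 (tgt w)"
  shows "homotopic E (Step (tgt w) GenInv (Step x Gen w)) w"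
  using homotopic.h5_right[OF homotopic.h1_inv_gen, of "tgt w" E w] assms by auto

lemma homotopic_gen_inv:
  assumes "is_walk E w" "x = act E (-1) (tgt w)"
  shows "homotopic E (Step (tgt w) Gen (Step x GenInv w)) w"
  using homotopic.h5_right[OF homotopic.h1_gen_inv, of "tgt w" E w] assms by auto

lemma homotopic_tau:
  assumes "is_walk E w"
  shows "homotopic E (Step (tgt w) Tau w) w"
  using homotopic.h5_right[OF homotopic.h1_tau, of "tgt w" E w] assms by auto

lemma homotopic_tau_tau:
  assumes "is_walk E w" "y \<in> carrier E" "z \<in> carrier E"
    "Pcls E y = Pcls E (tgt w)" "Pcls E z = Pcls E (tgt w)"
  shows "homotopic E (Step z Tau (Step y Tau w)) (Step z Tau w)"
  using homotopic.h5_right[OF homotopic.h2, of "tgt w" E y z w] assms by auto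

section \<open>Integer powers of the generator, up to homotopy\<close>

lemma pow_walk_Suc:
  assumes "x \<in> carrier E"
  shows "homotopic E (Step (act E (n + 1) x) Gen (pow_walk E n x)) (pow_walk E (n + 1) x)"
proof (cases "n \<ge> 0")
  case True
  then have "nat (n + 1) = Suc (nat n)" "int (Suc (nat n)) = n + 1" by auto
  then have "Step (act E (n + 1) x) Gen (pow_walk E n x) = pow_walk E (n + 1) x"
    using True by (simp add: pow_walk_def add.commute)
  then show ?thesis
    using homotopic.refl[OF walk_pow[OF assms]] by simp
next
  case False
  \<comment> \<open>A negative power ends in a \<open>GenInv\<close> step, which the additional
    \<open>Gen\<close> cancels by (h1).\<close>
  then have n: "nat (- n) = Suc (nat (- (n + 1)))" "- int (Suc (nat (- (n + 1)))) = n" by linarith+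
  have "pow_walk E n x = Step (act E n x) GenInv (neg_walk E (nat (- (n + 1))) x)"
    using False unfolding pow_walk_def n(1) neg_walk.simps n(2) by simp
  also have "neg_walk E (nat (- (n + 1))) x = pow_walk E (n + 1) x"
    using False by (auto simp: pow_walk_def)
  finally show ?thesis
    using homotopic_gen_inv[of "pow_walk E (n + 1) x" "act E n x"] assms by simp
qed

lemma pow_walk_pred:
  assumes "x \<in> carrier E"
  shows "homotopic E (Step (act E (n - 1) x) GenInv (pow_walk E n x)) (pow_walk E (n - 1) x)"
proof -
  have "homotopic E (Step (act E (n - 1) x) GenInv (pow_walk E n x))
     (Step (act E (n - 1) x) GenInv (Step (act E n x) Gen (pow_walk E (n - 1) x)))"
    using homotopic.sym[OF pow_walk_Suc[OF assms, of "n - 1"]] assms by (intro homotopic_Step) auto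
  also have "homotopic E \<dots> (pow_walk E (n - 1) x)"
    using homotopic_inv_gen[of "pow_walk E (n - 1) x" "act E n x"] assms by simp
  finally show ?thesis .
qed

lemma pow_walk_add:
  assumes "x \<in> carrier E" "y = act E n x"
  shows "homotopic E (pow_walk E m y \<cdot>\<^sub>w pow_walk E n x) (pow_walk E (m + n) x)"
proof (induction m rule: int_induct[where k = 0])
  case base
  then show ?case using assms by (simp add: pow_walk_def[of E 0] homotopic.refl)
next
  case (step1 m)
  let ?S = "Step (act E (m + 1 + n) x) Gen"
  have "homotopic E (pow_walk E (m + 1) y \<cdot>\<^sub>w pow_walk E n x) (?S (pow_walk E m y) \<cdot>\<^sub>w pow_walk E n x)"
    using homotopic.sym[OF pow_walk_Suc[of y m]] assms
    by (intro homotopic_comp) (auto intro: homotopic.refl)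
  also have "homotopic E \<dots> (?S (pow_walk E (m + n) x))"
    unfolding comp_walk.simps using step1(2) assms
    by (intro homotopic_Step) (auto simp: tgt_comp algebra_simps)
  also have "homotopic E \<dots> (pow_walk E (m + 1 + n) x)"
    using pow_walk_Suc[OF assms(1), of "m + n"] by (simp add: algebra_simps)
  finally show ?case .
next
  case (step2 m)
  let ?S = "Step (act E (m - 1 + n) x) GenInv"
  have "homotopic E (pow_walk E (m - 1) y \<cdot>\<^sub>w pow_walk E n x) (?S (pow_walk E m y) \<cdot>\<^sub>w pow_walk E n x)"
    using homotopic.sym[OF pow_walk_pred[of y m]] assms
    by (intro homotopic_comp) (auto intro: homotopic.refl)
  also have "homotopic E \<dots> (?S (pow_walk E (m + n) x))"
    unfolding comp_walk.simps using step2(2) assms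
    by (intro homotopic_Step) (auto simp: tgt_comp algebra_simps)
  also have "homotopic E \<dots> (pow_walk E (m - 1 + n) x)"
    using pow_walk_pred[OF assms(1), of "m + n"] by (simp add: algebra_simps)
  finally show ?case .
qed

text \<open>The action of the universal cover on representatives; on walks themselves it is additive
  only up to homotopy.\<close>

definition act_walk :: "int \<Rightarrow> 'a walk \<Rightarrow> 'a walk" where
  "act_walk n w = pow_walk E n (tgt w) \<cdot>\<^sub>w w"

lemma act_walk_ends [simp]:
  assumes "is_walk E w"
  shows "is_walk E (act_walk n w)" "src (act_walk n w) = src w" "tgt (act_walk n w) = act E n (tgt w)"
  using assms by (auto simp: act_walk_def tgt_comp intro!: walk_comp)

lemma act_walk_0 [simp]: "act_walk 0 w = w"
  by (simp add: act_walk_def pow_walk_def)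

lemma act_walk_cong:
  assumes "homotopic E v w" shows "homotopic E (act_walk n v) (act_walk n w)"
  using assms homotopic_ends[OF assms] unfolding act_walk_def by (auto intro!: homotopic_comp homotopic.refl)

lemma act_walk_act_walk:
  assumes "is_walk E w" shows "homotopic E (act_walk m (act_walk n w)) (act_walk (m + n) w)"
  using homotopic_comp[OF pow_walk_add[of "tgt w" "act E n (tgt w)" n m] homotopic.refl[of E w]] assms
  by (simp add: act_walk_def comp_assoc tgt_comp)

lemma act_walk_cancel:
  assumes "homotopic E (act_walk n v) (act_walk n w)" "is_walk E v" "is_walk E w"
  shows "homotopic E v w"
proof -
  have *: "homotopic E (act_walk (-n) (act_walk n u)) u" if "is_walk E u" for u
    using act_walk_act_walk[OF that, of "-n" n] by simp
  show ?thesis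
    using *[OF assms(2)] *[OF assms(3)] act_walk_cong[OF assms(1), of "-n"]
    by (meson homotopic.sym homotopic.trans)
qed

lemma Gen_act_walk:
  assumes "is_walk E w"
  shows "homotopic E (Step (act E 1 (tgt w)) Gen w) (act_walk 1 w)"
  using assms by (auto simp: act_walk_def pow_walk_def intro!: homotopic.refl)

lemma act_walk_tau_deg:
  assumes "is_walk E w" "y \<in> carrier E" "Pcls E y = Pcls E (tgt w)"
  shows "homotopic E (Step (act E (int (deg E y)) y) Tau (act_walk (int (deg E (tgt w))) w))
     (act_walk (int (deg E y)) (Step y Tau w))"
  using homotopic.h5_right[OF homotopic.h3, of "tgt w" E y w] assms
  by (auto simp: act_walk_def comp_assoc)

text \<open>(h3) for all integer powers of the Nakayama map. Both sides satisfy the same recursion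
  up to homotopy, passing from m to m + 1 by acting with g^{d(y)}; the induction goes up by
  congruence and down by \<open>act_walk_cancel\<close>.\<close>

lemma act_walk_tau:
  assumes "is_walk E w" "y \<in> carrier E" "Pcls E y = Pcls E (tgt w)"
  shows "homotopic E (Step (act E (n * int (deg E y)) y) Tau (act_walk (n * int (deg E (tgt w))) w))
     (act_walk (n * int (deg E y)) (Step y Tau w))" (is "homotopic E (?T n) (?M n)")
proof -
  let ?y = "int (deg E y)" and ?x = "int (deg E (tgt w))"
  note step = P_nakayama[OF assms(2) walk_tgt[OF assms(1)] assms(3)]
  have wT: "is_walk E (?T m)" for m using assms step by auto
  have wM: "is_walk E (?M m)" for m using assms by (intro act_walk_ends) auto
  have T: "homotopic E (?T (m + 1)) (act_walk ?y (?T m))" for m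
  proof -
    have "homotopic E (?T (m + 1))
       (Step (act E ((m + 1) * ?y) y) Tau (act_walk ?x (act_walk (m * ?x) w)))"
      using homotopic.sym[OF act_walk_act_walk[OF assms(1), of ?x "m * ?x"]] assms step[of "m + 1"]
      by (intro homotopic_Step) (auto simp: algebra_simps)
    also have "homotopic E \<dots> (act_walk ?y (?T m))"
      using act_walk_tau_deg[of "act_walk (m * ?x) w" "act E (m * ?y) y"] assms step[of m]
      by (simp add: algebra_simps)
    finally show ?thesis .
  qed
  have M: "homotopic E (act_walk ?y (?M m)) (?M (m + 1))" for m
    using act_walk_act_walk[of "Step y Tau w" ?y "m * ?y"] assms by (simp add: algebra_simps)
  show ?thesis
  proof (induction n rule: int_induct[where k = 0])
    case base
    then show ?case using wT[of 0] assms by (simp add: homotopic.refl)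
  next
    case (step1 n)
    show ?case
      by (rule homotopic.trans[OF homotopic.trans[OF T act_walk_cong[OF step1(2)]] M])
  next
    case (step2 n)
    have "homotopic E (act_walk ?y (?T (n - 1))) (act_walk ?y (?M (n - 1)))"
      using homotopic.trans[OF homotopic.trans[OF homotopic.sym[OF T[of "n - 1"]]] homotopic.sym[OF M[of "n - 1"]]]
        step2(2) by simp
    then show ?case using act_walk_cancel wT wM by blast
  qed
qed

end

section \<open>Special walks\<close>

text \<open>A canonical representative of the class P'(w): among special walks with a common source,
  lying in one class means having the same stem.\<close>

primrec stem :: "'a walk \<Rightarrow> 'a walk" where
  "stem (Triv x) = Triv x"
| "stem (Step y \<delta> w) = (if \<delta> = Tau then w else Step y \<delta> w)"

text \<open>
  The inductive form of special walks. The condition \<open>stem w = w\<close> says that \<open>w\<close> does not end in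
  $\tau$, that is, its last exponent is positive unless \<open>w\<close> is trivial.
\<close>

primrec reduced :: "('a, 'b) fbc_scheme \<Rightarrow> 'a walk \<Rightarrow> bool" where
  "reduced E (Triv x) \<longleftrightarrow> x \<in> carrier E"
| "reduced E (Step y \<delta> w) \<longleftrightarrow> reduced E w \<and> y \<in> carrier E \<and>
     (case \<delta> of
        Gen \<Rightarrow> y = act E 1 (tgt w) \<and> Suc (last_exp w) < deg E (tgt w)
      | GenInv \<Rightarrow> False
      | Tau \<Rightarrow> Pcls E y = Pcls E (tgt w) \<and> y \<noteq> tgt w \<and> stem w = w)"

lemma stem_last_exp: "last_exp w > 0 \<Longrightarrow> stem w = w"
  by (cases w) (auto split: if_splits)

lemma stem_neq_Tau: "w = Step y Tau u \<Longrightarrow> stem w \<noteq> w"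
proof
  assume "w = Step y Tau u" "stem w = w"
  then have "size w = size u" by simp
  then show False using \<open>w = Step y Tau u\<close> by simp
qed

lemma reset_exp_0: "last_exp w = 0 \<Longrightarrow> reset_exp w = w"
  by (cases w) auto

lemma last_exp_reset [simp]: "last_exp (reset_exp w) = 0"
  by (induction w) auto

lemma src_reset [simp]: "src (reset_exp w) = src w"
  by (induction w) auto

lemma special_form_cong:
  assumes "\<And>l. l \<le> k \<Longrightarrow> x l = x' l \<and> i l = i' l"
  shows "special_form E x i k = special_form E x' i' k"
  using assms by (induction k) auto

context fBC
begin

lemma reduced_is_walk: "reduced E w \<Longrightarrow> is_walk E w"
  by (induction w) (auto split: letter.splits)

lemma reduced_tgt [simp]: "reduced E w \<Longrightarrow> tgt w \<in> carrier E"
  using reduced_is_walk by simp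

lemma last_exp_less: "reduced E w \<Longrightarrow> last_exp w < deg E (tgt w)"
  by (induction w) (auto simp: deg_pos split: letter.splits)

lemma act_walk_Suc: "act_walk (int (Suc j)) w = Step (act E (int (Suc j)) (tgt w)) Gen (act_walk (int j) w)"
  by (simp add: act_walk_def pow_walk_def del: of_nat_Suc)

text \<open>The degree is constant along the orbit, so one bound on the final exponent keeps every
  intermediate walk special.\<close>

lemma reduced_act_walk:
  assumes "reduced E w" "last_exp w + j < deg E (tgt w)"
  shows "reduced E (act_walk (int j) w) \<and> last_exp (act_walk (int j) w) = last_exp w + j
    \<and> reset_exp (act_walk (int j) w) = reset_exp w"
  using assms(2)
proof (induction j)
  case 0
  then show ?case using assms by simp
next
  case (Suc j)
  then show ?case
    unfolding act_walk_Suc using assms(1) reduced_is_walk[OF assms(1)] by simp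
qed

text \<open>Splits off the last block g^{i_k}, so that wrap-around computations can start from
  exponent 0.\<close>

lemma act_walk_reset:
  assumes "reduced E w"
  shows "reduced E (reset_exp w) \<and> act_walk (int (last_exp w)) (reset_exp w) = w"
  using assms
proof (induction w)
  case (Step y \<delta> w)
  show ?case
  proof (cases "\<delta> = Gen")
    case True
    then have IH: "reduced E (reset_exp w)" "act_walk (int (last_exp w)) (reset_exp w) = w"
      using Step by auto
    then have "tgt w = act E (int (last_exp w)) (tgt (reset_exp w))"
      using act_walk_ends(3)[OF reduced_is_walk[OF IH(1)], of "int (last_exp w)"] by simp
    then show ?thesis using Step(2) True IH act_walk_Suc[of "last_exp w" "reset_exp w"] by simp
  next
    case False
    then show ?thesis using Step by auto
  qed
qed auto

lemma tgt_eq_reset: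
  assumes "reduced E w" shows "tgt w = act E (int (last_exp w)) (tgt (reset_exp w))"
  using act_walk_reset[OF assms] act_walk_ends(3)[OF reduced_is_walk, of "reset_exp w" "int (last_exp w)"] by simp

lemma special_form_reduced:
  assumes "is_walk E (special_form E x i k)" "\<And>l. l \<le> k \<Longrightarrow> i l < deg E (x l)"
    "\<And>l. 1 \<le> l \<Longrightarrow> l < k \<Longrightarrow> 0 < i l"
    "\<And>j. j \<in> {1..k} \<Longrightarrow> x j \<noteq> act E (int (i (j - 1))) (x (j - 1))"
  shows "x k \<in> carrier E \<and> reduced E (special_form E x i k)
    \<and> last_exp (special_form E x i k) = i k \<and> tgt (special_form E x i k) = act E (int (i k)) (x k)"
  using assms
proof (induction k)
  case 0
  have "src (special_form E x i 0) \<in> carrier E" using 0(1) walk_src by blast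
  then have x: "x 0 \<in> carrier E" by simp
  have "special_form E x i 0 = act_walk (int (i 0)) (Triv (x 0))"
    by (simp add: act_walk_def comp_Triv)
  then show ?case using reduced_act_walk[of "Triv (x 0)" "i 0"] 0(2)[of 0] x by simp
next
  case (Suc k)
  let ?w = "special_form E x i k"
  have wD: "is_walk E v" if "is_walk E (u \<cdot>\<^sub>w v)" for u v
    using that by (induction u) auto
  have walk: "is_walk E (Step (x (Suc k)) Tau ?w)"
    by (rule wD[OF Suc.prems(1)[unfolded special_form.simps]])
  have IH: "x k \<in> carrier E" "reduced E ?w" "last_exp ?w = i k" "tgt ?w = act E (int (i k)) (x k)"
    using Suc.IH walk Suc.prems(2-4) by auto
  \<comment> \<open>Only the first exponent may vanish below a tau; for k = 0 and i_0 = 0 the walk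
    is trivial, and \<open>stem\<close> fixes it.\<close>
  have "stem ?w = ?w"
  proof (cases "i k > 0")
    case True
    then show ?thesis using stem_last_exp IH by metis
  next
    case False
    then have "k = 0" using Suc.prems(3)[of k] by (cases k) auto
    then show ?thesis using False by (simp add: pow_walk_def)
  qed
  then have r: "reduced E (Step (x (Suc k)) Tau ?w)"
    using IH walk Suc.prems(4)[of "Suc k"] by simp
  have "special_form E x i (Suc k) = act_walk (int (i (Suc k))) (Step (x (Suc k)) Tau ?w)"
    by (simp add: act_walk_def)
  then show ?case using reduced_act_walk[OF r, of "i (Suc k)"] Suc.prems(2)[of "Suc k"] walk by simp
qed

lemma reduced_special_form:
  assumes "reduced E w"
  shows "\<exists>k x i. w = special_form E x i k \<and> (\<forall>l\<le>k. i l < deg E (x l)) \<and>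
     (\<forall>l. 1 \<le> l \<and> l < k \<longrightarrow> 0 < i l) \<and>
     (\<forall>j\<in>{1..k}. x j \<noteq> act E (int (i (j - 1))) (x (j - 1)))"
  using assms
proof (induction w)
  case (Triv a)
  then have "Triv a = special_form E (\<lambda>_. a) (\<lambda>_. 0) 0 \<and> 0 < deg E a"
    by (simp add: pow_walk_def deg_pos)
  then show ?case by (intro exI[of _ 0] exI[of _ "\<lambda>_. a"] exI[of _ "\<lambda>_. 0"]) simp
next
  case (Step y \<delta> w)
  then obtain k x i where w: "w = special_form E x i k"
    and deg: "\<And>l. l \<le> k \<Longrightarrow> i l < deg E (x l)" and pos: "\<And>l. 1 \<le> l \<Longrightarrow> l < k \<Longrightarrow> 0 < i l"
    and neq: "\<And>j. j \<in> {1..k} \<Longrightarrow> x j \<noteq> act E (int (i (j - 1))) (x (j - 1))"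
    by auto
  have r: "reduced E w" using Step.prems by simp
  have xk: "x k \<in> carrier E" and li: "last_exp w = i k" and tw: "tgt w = act E (int (i k)) (x k)"
    using special_form_reduced[of x i k, OF _ deg pos neq] reduced_is_walk[OF r] by (simp_all add: w)
  consider "\<delta> = Gen" | "\<delta> = Tau" using Step.prems by (cases \<delta>) auto
  then show ?case
  proof cases
    case 1
    let ?i = "i(k := Suc (i k))"
    have pow: "pow_walk E (int (Suc n)) a = Step (act E (int (Suc n)) a) Gen (pow_walk E (int n) a)" for n a
      by (simp add: pow_walk_def del: of_nat_Suc)
    have "special_form E x ?i k = Step (act E (int (Suc (i k))) (x k)) Gen w"
    proof (cases k)
      case 0
      then show ?thesis using w by (simp add: pow del: of_nat_Suc)
    next
      case (Suc m)
      then have "special_form E x ?i m = special_form E x i m" by (intro special_form_cong) auto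
      then show ?thesis using w Suc by (simp add: pow del: of_nat_Suc)
    qed
    then have "Step y \<delta> w = special_form E x ?i k" "Suc (i k) < deg E (x k)"
      using Step.prems 1 tw xk li by auto
    moreover have "\<forall>l\<le>k. ?i l < deg E (x l)" "\<forall>l. 1 \<le> l \<and> l < k \<longrightarrow> 0 < ?i l"
        "\<forall>j\<in>{1..k}. x j \<noteq> act E (int (?i (j - 1))) (x (j - 1))"
      using calculation(2) deg pos neq by auto
    ultimately show ?thesis by blast
  next
    case 2
    let ?x = "x(Suc k := y)" and ?i = "i(Suc k := 0)"
    have "special_form E ?x ?i k = w" unfolding w by (intro special_form_cong) auto
    then have "Step y \<delta> w = special_form E ?x ?i (Suc k)"
      using 2 by (simp add: pow_walk_def)
    \<comment> \<open>The former last exponent becomes an inner one. Were it 0 with k > 0, then w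
      would end in tau, against \<open>stem w = w\<close>.\<close>
    moreover have "0 < i l" if "1 \<le> l" "l < Suc k" for l
    proof (cases "l = k")
      case True
      show ?thesis
      proof (rule ccontr)
        assume "\<not> 0 < i l"
        then have "w = Step (x k) Tau (special_form E x i (k - 1))"
          using w True that by (cases k) (auto simp: pow_walk_def)
        then show False using stem_neq_Tau Step.prems 2 by auto
      qed
    qed (use pos that in auto)
    then have "\<forall>l. 1 \<le> l \<and> l < Suc k \<longrightarrow> 0 < ?i l" by auto
    moreover have "y \<noteq> act E (int (i k)) (x k)" "0 < deg E y"
      using Step.prems 2 tw deg_pos by auto
    then have "\<forall>l\<le>Suc k. ?i l < deg E (?x l)"
        "\<forall>j\<in>{1..Suc k}. ?x j \<noteq> act E (int (?i (j - 1))) (?x (j - 1))"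
      using deg neq by (auto simp: le_Suc_eq)
    ultimately show ?thesis by blast
  qed
qed

text \<open>From here on, structural induction on walks replaces the data k, x, i of the explicit
  form.\<close>

lemma special_iff_reduced: "special E w \<longleftrightarrow> reduced E w"
proof
  assume "special E w"
  then obtain k x i where w: "is_walk E w" "w = special_form E x i k" and i: "i 0 < deg E (x 0)"
      "i k < deg E (x k)" "\<And>l. 1 \<le> l \<Longrightarrow> l < k \<Longrightarrow> 0 < i l \<and> i l < deg E (x l)"
      "\<And>j. j \<in> {1..k} \<Longrightarrow> x j \<noteq> act E (int (i (j - 1))) (x (j - 1))"
    unfolding special_def by blast
  have "i l < deg E (x l)" if "l \<le> k" for l
    using i(1-3) that by (cases "l = 0"; cases "l = k") auto
  then show "reduced E w"
    using special_form_reduced[of x i k] w i(3,4) by blast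
next
  assume "reduced E w"
  then show "special E w"
    using reduced_special_form[of w] reduced_is_walk[of w] unfolding special_def
    by (metis le0 le_refl less_imp_le)
qed

lemma B_set_eq: "B_set E e = {w. reduced E w \<and> src w = e}"
  by (simp add: B_set_def special_iff_reduced)

section \<open>The configurations of special walks\<close>

text \<open>The recursion of \<open>B_class\<close> stops after at most one step, since no two tau
  steps are adjacent in a special walk.\<close>

lemma B_class_eq:
  assumes "reduced E w"
  shows "B_class E w = insert (stem w) {Step h Tau (stem w) | h. h \<in> Pcls E (tgt (stem w)) \<and> h \<noteq> tgt (stem w)}"
proof -
  have *: "B_class E v = insert v {Step h Tau v | h. h \<in> Pcls E (tgt v) \<and> h \<noteq> tgt v}"
    if "reduced E v" "stem v = v" for v
    using that stem_neq_Tau[of v] by (cases v) auto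
  show ?thesis
    using * assms by (cases w) (auto split: letter.splits)
qed

lemma reduced_stem:
  assumes "reduced E w"
  shows "reduced E (stem w)" "src (stem w) = src w" "Pcls E (tgt (stem w)) = Pcls E (tgt w)" "stem (stem w) = stem w"
  using assms by (cases w; auto split: letter.splits)+

lemma B_class_fibre:
  assumes "w \<in> B_set E e"
  shows "B_class E w = {v \<in> B_set E e. stem v = stem w}"
proof -
  have r: "reduced E w" "src w = e" using assms by (auto simp: B_set_eq)
  note s = reduced_stem[OF r(1)]
  show ?thesis
  proof (intro equalityI subsetI)
    fix v assume "v \<in> B_class E w"
    then show "v \<in> {v \<in> B_set E e. stem v = stem w}"
      unfolding B_class_eq[OF r(1)] using r s mem_P_iff[of "tgt (stem w)"]
      by (auto simp: B_set_eq)
  next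
    fix v assume v: "v \<in> {v \<in> B_set E e. stem v = stem w}"
    then show "v \<in> B_class E w"
      unfolding B_class_eq[OF r(1)] using s mem_P_iff[of "tgt (stem w)"]
      by (cases v) (auto simp: B_set_eq split: if_splits)
  qed
qed

lemma B_conf_P:
  assumes "w \<in> B_set E e"
  shows "Pcls (B_conf E e) w = {v \<in> B_set E e. stem v = stem w}"
  using partition_on_fibres(2)[of "B_set E e" "B_class E" stem w] B_class_fibre assms
  by (simp add: B_conf_def)

text \<open>A class consists of its stem and one tau extension for each other element of the P-class
  of the stem's end point, so every target occurs exactly once. This is the source of finiteness and
  of the covering property.\<close>

lemma tgt_bij_star:
  assumes "reduced E w"
  shows "bij_betw tgt {v \<in> B_set E (src w). stem v = stem w} (Pcls E (tgt w))"
proof -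
  note s = reduced_stem[OF assms]
  have P: "Pcls E (tgt w) = Pcls E (tgt (stem w))" using s by simp
  have "w \<in> B_set E (src w)" using assms by (simp add: B_set_eq)
  then have "{v \<in> B_set E (src w). stem v = stem w} =
      insert (stem w) {Step h Tau (stem w) | h. h \<in> Pcls E (tgt (stem w)) \<and> h \<noteq> tgt (stem w)}"
    using B_class_fibre[of w "src w"] B_class_eq[OF assms] by simp
  then show ?thesis
    using P_self[of "tgt (stem w)"] s(1) unfolding P
    by (auto simp: bij_betw_def inj_on_def intro: image_eqI[where x = "Step x Tau (stem w)" for x])
qed

section \<open>The generator on special walks and its inverse\<close>

definition ZB_step_inv :: "'a walk \<times> int \<Rightarrow> 'a walk \<times> int" where
  "ZB_step_inv = (\<lambda>(w, n). case w of
     Step y Gen u \<Rightarrow> (u, n)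
   | _ \<Rightarrow> (act_walk (int (deg E (tgt w) - 1)) w, n - 1))"

lemma last_exp_pos:
  "\<lbrakk>reduced E w; last_exp w > 0\<rbrakk> \<Longrightarrow>
    \<exists>u. w = Step (act E 1 (tgt u)) Gen u \<and> reduced E u \<and> Suc (last_exp u) < deg E (tgt u)"
  by (cases w) (auto split: letter.splits if_splits)

text \<open>Agrees with \<open>ZB_gen\<close> on the carrier, but avoids
  \<open>act (B_conf E e) 1\<close>, which is known to be \<open>B_gen\<close> only once
  \<open>B_gen\<close> is shown bijective.\<close>

definition ZB_step :: "'a walk \<times> int \<Rightarrow> 'a walk \<times> int" where
  "ZB_step = (\<lambda>(w, n). (B_gen E w, if last_exp w < deg E (tgt w) - 1 then n else n + 1))"

lemma ZB_step_inv_Gen: "last_exp w = 0 \<Longrightarrow> ZB_step_inv (w, n) = (act_walk (int (deg E (tgt w) - 1)) w, n - 1)"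
  by (cases w) (auto simp: ZB_step_inv_def split: letter.splits)

text \<open>Going back either drops a final \<open>Gen\<close> or, at last exponent 0, jumps to
  exponent d - 1 and lowers the integer by one.\<close>

lemma ZB_step_back:
  assumes "reduced E w"
  shows "ZB_step (ZB_step_inv (w, n)) = (w, n) \<and> reduced E (fst (ZB_step_inv (w, n)))
    \<and> src (fst (ZB_step_inv (w, n))) = src w"
proof (cases "last_exp w > 0")
  case True
  then obtain u where u: "w = Step (act E 1 (tgt u)) Gen u" "reduced E u" "Suc (last_exp u) < deg E (tgt u)"
    using last_exp_pos assms by blast
  have "ZB_step_inv (w, n) = (u, n)" unfolding ZB_step_inv_def u(1) by simp
  then show ?thesis using u by (simp add: ZB_step_def B_gen_def)
next
  case False
  let ?v = "act_walk (int (deg E (tgt w) - 1)) w"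
  have v: "reduced E ?v" "last_exp ?v = deg E (tgt w) - 1" "reset_exp ?v = w"
    using reduced_act_walk[OF assms, of "deg E (tgt w) - 1"] False deg_pos[of "tgt w"] assms
      reset_exp_0[of w] by auto
  have "ZB_step_inv (w, n) = (?v, n - 1)" using False by (simp add: ZB_step_inv_Gen)
  then show ?thesis
    using v reduced_is_walk[OF assms] by (simp add: ZB_step_def B_gen_def)
qed

lemma back_ZB_step:
  assumes "reduced E w"
  shows "ZB_step_inv (ZB_step (w, n)) = (w, n) \<and> reduced E (fst (ZB_step (w, n)))
    \<and> src (fst (ZB_step (w, n))) = src w"
proof (cases "last_exp w < deg E (tgt w) - 1")
  case True
  then show ?thesis using assms by (simp add: ZB_step_def B_gen_def ZB_step_inv_def)
next
  case False
  then have l: "last_exp w = deg E (tgt w) - 1" using last_exp_less[OF assms] by simp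
  have r: "reduced E (reset_exp w)" "act_walk (int (last_exp w)) (reset_exp w) = w"
    using act_walk_reset[OF assms] by auto
  have "deg E (tgt (reset_exp w)) = deg E (tgt w)"
    using tgt_eq_reset[OF assms] r(1) by simp
  then have "ZB_step_inv (reset_exp w, n + 1) = (w, n)"
    using ZB_step_inv_Gen[of "reset_exp w" "n + 1"] r l by simp
  then show ?thesis
    using False r by (simp add: ZB_step_def B_gen_def)
qed

lemma ZB_step_bij: "bij_betw ZB_step (B_set E e \<times> UNIV) (B_set E e \<times> UNIV)"
proof (rule bij_betw_byWitness[where f' = ZB_step_inv])
  show "ZB_step ` (B_set E e \<times> UNIV) \<subseteq> B_set E e \<times> UNIV"
    using back_ZB_step by (intro image_subsetI) (auto simp: B_set_eq mem_Times_iff)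
  show "ZB_step_inv ` (B_set E e \<times> UNIV) \<subseteq> B_set E e \<times> UNIV"
    using ZB_step_back by (intro image_subsetI) (auto simp: B_set_eq mem_Times_iff)
qed (use ZB_step_back back_ZB_step in \<open>auto simp: B_set_eq\<close>)

text \<open>The walk components of \<open>ZB_step\<close> and its inverse do not depend on the
  integer, so bijectivity descends to B.\<close>

lemma B_gen_bij: "bij_betw (B_gen E) (B_set E e) (B_set E e)"
proof -
  have gen: "B_gen E w = fst (ZB_step (w, n))" for w n by (simp add: ZB_step_def)
  have bk: "fst (ZB_step_inv (w, m)) = fst (ZB_step_inv (w, n))" for w m n
    by (cases w) (auto simp: ZB_step_inv_def split: letter.splits)
  have "fst (ZB_step_inv (B_gen E w, 0)) = fst (ZB_step_inv (ZB_step (w, 0)))" for w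
    unfolding gen[of w 0] by (metis bk prod.collapse)
  moreover have "B_gen E (fst (ZB_step_inv (w, 0))) = fst (ZB_step (ZB_step_inv (w, 0)))" for w
    by (metis gen prod.collapse)
  ultimately show ?thesis
    using ZB_step_back[where n = 0] back_ZB_step[where n = 0] gen
    by (intro bij_betw_byWitness[where f' = "\<lambda>w. fst (ZB_step_inv (w, 0))"]) (auto simp: B_set_eq)
qed

end

section \<open>Lifting walks along a covering\<close>

text \<open>For g steps equivariance forces the lift, so the letter suffices; for tau steps the
  description is well defined because a covering is bijective on P-classes.\<close>

primrec lift :: "('b, 'c) fbc_scheme \<Rightarrow> ('b \<Rightarrow> 'a) \<Rightarrow> 'b \<Rightarrow> 'a walk \<Rightarrow> 'b" where
  "lift X q z (Triv x) = z"
| "lift X q z (Step y \<delta> v) =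
     (case \<delta> of
        Gen \<Rightarrow> act X 1 (lift X q z v)
      | GenInv \<Rightarrow> act X (-1) (lift X q z v)
      | Tau \<Rightarrow> (THE u. u \<in> Pcls X (lift X q z v) \<and> q u = y))"

lemma lift_comp: "lift X q z (u \<cdot>\<^sub>w v) = lift X q (lift X q z v) u"
  by (induction u) (auto split: letter.split)

locale covering_map = X: fBC X + E: fBC E for X :: "('b, 'c) fbc_scheme" and E :: "('a, 'd) fbc_scheme" +
  fixes q :: "'b \<Rightarrow> 'a"
  assumes covering: "fbc_covering X E q"
begin

lemma q_closed [simp]: "x \<in> carrier X \<Longrightarrow> q x \<in> carrier E"
  using covering unfolding fbc_covering_def fbc_morphism_def by auto

lemma q_act [simp]: "x \<in> carrier X \<Longrightarrow> q (act X n x) = act E n (q x)"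
  using covering unfolding fbc_covering_def fbc_morphism_def by auto

lemma q_deg [simp]: "x \<in> carrier X \<Longrightarrow> deg E (q x) = deg X x"
  using covering unfolding fbc_covering_def fbc_morphism_def by auto

lemma q_P: "x \<in> carrier X \<Longrightarrow> bij_betw q (Pcls X x) (Pcls E (q x))"
  using covering unfolding fbc_covering_def by auto

lemma q_L: "x \<in> carrier X \<Longrightarrow> bij_betw q (Lcls X x) (Lcls E (q x))"
  using covering unfolding fbc_covering_def by auto

lemma the_tau:
  assumes "x \<in> carrier X" "u \<in> Pcls X x"
  shows "(THE v. v \<in> Pcls X x \<and> q v = q u) = u"
  using assms q_P[OF assms(1)] by (intro the_equality) (auto simp: bij_betw_def inj_on_def)

lemma ex_tau:
  assumes "x \<in> carrier X" "y \<in> Pcls E (q x)"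
  obtains u where "u \<in> Pcls X x" "u \<in> carrier X" "Pcls X u = Pcls X x" "q u = y"
    "(THE v. v \<in> Pcls X x \<and> q v = y) = u"
proof -
  have "y \<in> q ` Pcls X x"
    using assms q_P[OF assms(1)] by (simp add: bij_betw_def)
  then obtain u where u: "u \<in> Pcls X x" "q u = y" by blast
  then show ?thesis
    using that[of u] the_tau[OF assms(1) u(1)] X.mem_P_iff[OF assms(1)] by auto
qed

lemma lift_closed:
  assumes "is_walk E v" "z \<in> carrier X" "q z = src v"
  shows "lift X q z v \<in> carrier X \<and> q (lift X q z v) = tgt v"
  using assms
proof (induction v)
  case (Step y \<delta> v)
  then have IH: "lift X q z v \<in> carrier X" "q (lift X q z v) = tgt v" by auto
  show ?case
  proof (cases \<delta>)
    case Tau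
    then have "y \<in> Pcls E (q (lift X q z v))"
      using Step.prems(1) IH E.mem_P_iff[of "tgt v"] by auto
    then obtain u where "u \<in> Pcls X (lift X q z v)" "u \<in> carrier X"
        "Pcls X u = Pcls X (lift X q z v)" "q u = y" "(THE u. u \<in> Pcls X (lift X q z v) \<and> q u = y) = u"
      by (rule ex_tau[OF IH(1)])
    then show ?thesis using Tau by simp
  qed (use Step.prems(1) IH in auto)
qed auto

lemma lift_pow:
  assumes "z \<in> carrier X"
  shows "lift X q z (pow_walk E n x) = act X n z"
proof -
  have "lift X q z (pos_walk E k x) = act X (int k) z" "lift X q z (neg_walk E k x) = act X (- int k) z" for k
    using assms by (induction k) auto
  then show ?thesis by (simp add: pow_walk_def)
qed

lemma lift_homotopic:
  assumes "homotopic E v w" "z \<in> carrier X" "q z = src v"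
  shows "lift X q z v = lift X q z w"
  using assms
proof (induction arbitrary: z rule: homotopic.induct)
  case (sym w v)
  then show ?case using E.homotopic_ends by metis
next
  case (trans u v w)
  then show ?case using E.homotopic_ends by metis
next
  case (h1_tau x)
  then show ?case using the_tau[of z z] by simp
next
  case (h2 x y y')
  then have "y \<in> Pcls E (q z)" using E.mem_P_iff[of "q z" y] by simp
  then obtain u where u: "u \<in> Pcls X z" "u \<in> carrier X" "Pcls X u = Pcls X z" "q u = y"
      "(THE v. v \<in> Pcls X z \<and> q v = y) = u"
    by (rule ex_tau[OF h2(6)])
  show ?case by (simp add: u)
next
  case (h3 x y)
  then have x: "x = q z" by simp
  have "y \<in> Pcls E (q z)" using E.mem_P_iff[of "q z" y] h3 by simp
  then obtain u where u: "u \<in> Pcls X z" "u \<in> carrier X" "Pcls X u = Pcls X z" "q u = y"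
      "(THE v. v \<in> Pcls X z \<and> q v = y) = u"
    by (rule ex_tau[OF h3(4)])
  have dy: "deg E y = deg X u" using q_deg[OF u(2)] u(4) by simp
  \<comment> \<open>Since q preserves degrees, both sides turn by the matching exponents; (f4) in X
    puts their ends into one P-class, so the final tau step lifts to the end of the turn from
    u.\<close>
  have "act X (int (deg X u)) u \<in> Pcls X (act X (int (deg X z)) z)"
    using X.P_nakayama[OF h3(4) u(2), of 1] u X.mem_P_iff h3(4) by simp
  from the_tau[OF _ this] show ?case
    using h3(4) u by (simp add: x dy lift_comp lift_pow)
next
  case (h4 x y)
  then have "y \<in> Lcls E (q z)" using E.mem_L_iff[of "q z" y] by auto
  \<comment> \<open>Bijectivity on L-classes supplies the lift of y inside L(z), which (f2)
    requires; as L(z) lies in P(z), it is also the tau lift.\<close>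
  then have "y \<in> q ` Lcls X z" using q_L[OF h4(4)] by (simp add: bij_betw_def)
  then obtain u where u: "u \<in> Lcls X z" "q u = y" by blast
  then have uP: "u \<in> Pcls X z" and uc: "u \<in> carrier X" "Lcls X u = Lcls X z"
    using X.f1[OF h4(4)] X.mem_L_iff[OF h4(4)] by auto
  have "act X 1 u \<in> Pcls X (act X 1 z)"
    using X.f2[OF uc(1) h4(4)] uc X.mem_P_iff h4(4) by simp
  from the_tau[OF _ this] show ?case
    using h4(4) u uc the_tau[OF h4(4) uP] by simp
next
  case (h5_left w w' u)
  then show ?case by (simp add: lift_comp)
next
  case (h5_right w w' v)
  then show ?case using lift_closed[of v z] by (simp add: lift_comp)
qed auto

end

section \<open>The configuration $\mathbb{Z}B_{(E,e)}$\<close>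

context fBC
begin

lemma carrier_ZB [simp]: "carrier (ZB_conf E e) = B_set E e \<times> UNIV"
  by (simp add: ZB_conf_def B_conf_def)

lemma deg_ZB: "deg (ZB_conf E e) (w, n) = deg E (tgt w)"
  by (simp add: ZB_conf_def)

lemma ZB_gen_eq:
  assumes "x \<in> B_set E e \<times> UNIV" shows "ZB_gen E e x = ZB_step x"
  using assms action_of_1[OF B_gen_bij] by (auto simp: ZB_gen_def ZB_step_def B_conf_def)

lemma ZB_gen_bij: "bij_betw (ZB_gen E e) (B_set E e \<times> UNIV) (B_set E e \<times> UNIV)"
  using bij_betw_cong[of "B_set E e \<times> UNIV" "ZB_gen E e" ZB_step] ZB_gen_eq ZB_step_bij by blast

lemma act_ZB: "act (ZB_conf E e) = action_of (B_set E e \<times> UNIV) (ZB_gen E e)"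
  by (simp add: ZB_conf_def B_conf_def)

lemma action_ZB: "group_action integer_group (B_set E e \<times> UNIV) (act (ZB_conf E e))"
  unfolding act_ZB by (rule group_action_action_of[OF ZB_gen_bij])

lemma act_ZB_1: "x \<in> B_set E e \<times> UNIV \<Longrightarrow> act (ZB_conf E e) 1 x = ZB_step x"
  unfolding act_ZB using action_of_1[OF ZB_gen_bij] ZB_gen_eq by simp

lemma B_set_closed: "\<lbrakk>w \<in> B_set E e; last_exp w + j < deg E (tgt w)\<rbrakk> \<Longrightarrow> act_walk (int j) w \<in> B_set E e"
  using reduced_act_walk[of w j] reduced_is_walk[of w] by (simp add: B_set_eq)

lemma act_ZB_nat:
  assumes "w \<in> B_set E e" "last_exp w + j < deg E (tgt w)"
  shows "act (ZB_conf E e) (int j) (w, n) = (act_walk (int j) w, n)"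
  using assms(2)
proof (induction j)
  case 0
  then show ?case using int_action_0[OF action_ZB] assms by simp
next
  case (Suc j)
  have r: "reduced E w" using assms by (simp add: B_set_eq)
  have IH: "act (ZB_conf E e) (int j) (w, n) = (act_walk (int j) w, n)" using Suc by simp
  have "act (ZB_conf E e) (int (Suc j)) (w, n) = ZB_step (act_walk (int j) w, n)"
    using int_action_add[OF action_ZB, of "(w, n)" e 1 "int j"] assms IH
      act_ZB_1[of "(act_walk (int j) w, n)" e] B_set_closed[of w e j] Suc.prems by simp
  also have "\<dots> = (act_walk (int (Suc j)) w, n)"
    using reduced_act_walk[OF r, of j] Suc.prems reduced_is_walk[OF r] r unfolding act_walk_Suc
    by (auto simp: ZB_step_def B_gen_def)
  finally show ?case .
qed

text \<open>From the reset walk, d - 1 steps raise the exponent to d - 1 and one more wraps around,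
  so g^d raises the integer by one. As g^d commutes with g^l, l the last exponent, this transfers to
  w itself.\<close>

lemma act_ZB_deg:
  assumes "w \<in> B_set E e"
  shows "act (ZB_conf E e) (m * int (deg E (tgt w))) (w, n) = (w, n + m)"
proof -
  let ?a = "act (ZB_conf E e)" and ?d = "int (deg E (tgt w))" and ?r = "reset_exp w" and ?l = "int (last_exp w)"
  have w: "reduced E w" using assms by (simp add: B_set_eq)
  have r: "?r \<in> B_set E e" "reduced E ?r" using act_walk_reset[OF w] assms by (auto simp: B_set_eq)
  have d: "deg E (tgt ?r) = deg E (tgt w)" using tgt_eq_reset[OF w] r by simp
  note add = int_action_add[OF action_ZB]
  have a: "?a ?l (?r, k) = (w, k)" for k
    using act_ZB_nat[OF r(1), of "last_exp w"] last_exp_less[OF w] act_walk_reset[OF w] d by simp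
  have dpos: "deg E (tgt w) > 0" using w deg_pos by simp
  have step: "?a ?d (w, k) = (w, k + 1)" for k
  proof -
    let ?j = "deg E (tgt w) - 1"
    have "?a ?d (?r, k) = ?a 1 (?a (int ?j) (?r, k))"
      using add[of "(?r, k)" e 1 "int ?j"] r dpos by (simp add: of_nat_diff)
    also have "\<dots> = ZB_step (act_walk (int ?j) ?r, k)"
      using act_ZB_nat[OF r(1), of ?j] act_ZB_1[of "(act_walk (int ?j) ?r, k)" e] B_set_closed[OF r(1), of ?j] d dpos
      by simp
    also have "\<dots> = (?r, k + 1)"
      using reduced_act_walk[OF r(2), of ?j] d dpos reduced_is_walk[OF r(2)] r(2) reset_exp_0[of ?r]
      by (simp add: ZB_step_def B_gen_def)
    finally have "?a (?l + ?d) (?r, k) = (w, k + 1)"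
      using add[of "(?r, k)" e ?l ?d] r a by simp
    moreover have "?a (?d + ?l) (?r, k) = ?a ?d (w, k)"
      using add[of "(?r, k)" e ?d ?l] r a by simp
    ultimately show ?thesis by (simp add: add.commute)
  qed
  show ?thesis
  proof (induction m rule: int_induct[where k = 0])
    case base
    then show ?case using int_action_0[OF action_ZB] assms by simp
  next
    case (step1 m)
    then show ?case
      using add[of "(w, n)" e ?d "m * ?d"] assms step by (simp add: algebra_simps)
  next
    case (step2 m)
    have "?a ((m - 1) * ?d) (w, n) = ?a (- ?d) (?a ?d (w, n + m - 1))"
      using add[of "(w, n)" e "- ?d" "m * ?d"] assms step step2(2) by (simp add: algebra_simps)
    also have "\<dots> = (w, n + m - 1)"
      using add[of "(w, n + m - 1)" e "- ?d" ?d] int_action_0[OF action_ZB] assms by simp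
    finally show ?case by (simp add: algebra_simps)
  qed
qed

lemma ZB_proj_closed: "x \<in> B_set E e \<times> UNIV \<Longrightarrow> ZB_proj E x \<in> carrier E"
  by (auto simp: ZB_proj_def B_set_eq)

lemma ZB_proj_act:
  assumes "x \<in> B_set E e \<times> UNIV"
  shows "ZB_proj E (act (ZB_conf E e) n x) = act E n (ZB_proj E x)"
proof (rule int_action_equivariant[OF action_ZB action ZB_proj_closed _ assms])
  fix x :: "'a walk \<times> int" assume x: "x \<in> B_set E e \<times> UNIV"
  then obtain w k where wk: "x = (w, k)" "reduced E w" by (auto simp: B_set_eq)
  have "ZB_proj E (ZB_step (w, k)) = act E 1 (ZB_proj E (w, k))"
  proof (cases "last_exp w < deg E (tgt w) - 1")
    case True
    then show ?thesis using wk(2) by (simp add: ZB_step_def B_gen_def ZB_proj_def add.commute)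
  next
    case False
    \<comment> \<open>At the wrap-around d = 1 + l and t(w) = g^l t(r) for the reset walk r, hence
      g^{1 + n d} t(w) = g^{(n+1) d} t(r).\<close>
    then have l: "int (deg E (tgt w)) = 1 + int (last_exp w)" using last_exp_less[OF wk(2)] by simp
    have "reduced E (reset_exp w)" using act_walk_reset wk by simp
    moreover from this have "deg E (tgt (reset_exp w)) = deg E (tgt w)"
      using tgt_eq_reset[OF wk(2)] by simp
    ultimately show ?thesis
      using False tgt_eq_reset[OF wk(2)] wk l
      by (simp add: ZB_step_def B_gen_def ZB_proj_def algebra_simps)
  qed
  then show "ZB_proj E (act (ZB_conf E e) 1 x) = act E 1 (ZB_proj E x)"
    using act_ZB_1[OF x] wk by simp
qed auto

lemma deg_ZB_proj: "x \<in> B_set E e \<times> UNIV \<Longrightarrow> deg (ZB_conf E e) x = deg E (ZB_proj E x)"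
  by (auto simp: ZB_proj_def deg_ZB B_set_eq)

lemma
  shows ZB_partition: "partition_on (B_set E e \<times> UNIV) (Ppart (ZB_conf E e))"
    and ZB_P: "w \<in> B_set E e \<Longrightarrow> Pcls (ZB_conf E e) (w, n) = {v \<in> B_set E e. stem v = stem w} \<times> {n}"
proof -
  have *: "(\<lambda>(w, n). Pcls (B_conf E e) w \<times> {n}) x
      = {y \<in> B_set E e \<times> UNIV. map_prod stem id y = map_prod stem id x}"
    if "x \<in> B_set E e \<times> UNIV" for x :: "'a walk \<times> int"
    using that B_conf_P by auto
  have P: "Ppart (ZB_conf E e) = (\<lambda>(w, n). Pcls (B_conf E e) w \<times> {n}) ` (B_set E e \<times> UNIV)"
    by (simp add: ZB_conf_def B_conf_def)
  show "partition_on (B_set E e \<times> UNIV) (Ppart (ZB_conf E e))"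
    unfolding P by (rule partition_on_fibres(1)[OF *])
  show "w \<in> B_set E e \<Longrightarrow> Pcls (ZB_conf E e) (w, n) = {v \<in> B_set E e. stem v = stem w} \<times> {n}"
    unfolding P using partition_on_fibres(2)[OF *, of "(w, n)"] * B_conf_P by simp
qed

lemma fms_BC_ZB: "fms_BC (ZB_conf E e)"
proof (rule fms_BC_intro)
  let ?Z = "ZB_conf E e"
  show "group_action integer_group (carrier ?Z) (act ?Z)" using action_ZB by simp
  show "partition_on (carrier ?Z) (Ppart ?Z)" using ZB_partition by simp
  show "Lpart ?Z = (\<lambda>x. {x}) ` carrier ?Z" by (simp add: ZB_conf_def B_conf_def)
  fix x assume "x \<in> carrier ?Z"
  then obtain w n where x: "x = (w, n)" and w: "w \<in> B_set E e" by auto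
  then have r: "reduced E w" "e = src w" by (auto simp: B_set_eq)
  have "finite {v \<in> B_set E e. stem v = stem w}"
    using tgt_bij_star[OF r(1)] f1[of "tgt w"] r by (simp add: bij_betw_finite)
  then show "finite (Pcls ?Z x)" using ZB_P w x by simp
  show "deg ?Z x > 0" using r deg_pos by (simp add: x deg_ZB)
  \<comment> \<open>The degree is that of the image under the equivariant \<open>ZB_proj\<close>, so
    its invariance comes from E.\<close>
  show "deg ?Z (act ?Z m x) = deg ?Z x" for m
    using deg_ZB_proj[of x] deg_ZB_proj[of "act ?Z m x" e] ZB_proj_act[of x e m]
      int_action_closed[OF action_ZB, of x e m] ZB_proj_closed[of x e] x w by simp
  fix y assume "y \<in> carrier ?Z"
  then obtain v m where y: "y = (v, m)" and v: "v \<in> B_set E e" by auto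
  \<comment> \<open>This settles (f4): g^d only shifts the integer coordinate, and a class is
    determined by stem and integer.\<close>
  have sh: "act ?Z (int (deg ?Z (u, k))) (u, k) = (u, k + 1)" if "u \<in> B_set E e" for u k
    using act_ZB_deg[OF that, of 1] by (simp add: deg_ZB)
  have iff: "Pcls ?Z (w, i) = Pcls ?Z (v, j) \<longleftrightarrow> stem w = stem v \<and> i = j" for i j
    unfolding ZB_P[OF w] ZB_P[OF v] times_eq_iff using v w by auto
  show "Pcls ?Z x = Pcls ?Z y \<longleftrightarrow> Pcls ?Z (act ?Z (int (deg ?Z x)) x) = Pcls ?Z (act ?Z (int (deg ?Z y)) y)"
    unfolding x y sh[OF v] sh[OF w] iff by simp
qed

end

text \<open>On the class of (w, n) the map factors as the projection to walks, the bijection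
  \<open>tgt\<close> onto P(t(w)), and the n-th power of y -> g^{d(y)} y, whose inverse is the
  (-n)-th power by \<open>P_nakayama\<close>. L-classes are singletons on both sides.\<close>

lemma (in fms_BC) covering_ZB: "fbc_covering (ZB_conf E e) E (ZB_proj E)"
proof -
  let ?Z = "ZB_conf E e"
  interpret Z: fms_BC ?Z by (rule fms_BC_ZB)
  have P: "bij_betw (ZB_proj E) (Pcls ?Z x) (Pcls E (ZB_proj E x))" if x: "x \<in> carrier ?Z" for x
  proof -
    obtain w n where x: "x = (w, n)" and w: "w \<in> B_set E e" using x by auto
    then have r: "reduced E w" "e = src w" by (auto simp: B_set_eq)
    let ?S = "{v \<in> B_set E e. stem v = stem w}"
    let ?s = "\<lambda>n y. act E (n * int (deg E y)) y"
    have "bij_betw fst (?S \<times> {n}) ?S" by (auto simp: bij_betw_def inj_on_def)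
    moreover have "bij_betw tgt ?S (Pcls E (tgt w))" using tgt_bij_star[OF r(1)] r by simp
    moreover have "bij_betw (?s n) (Pcls E (tgt w)) (Pcls E (?s n (tgt w)))"
    proof -
      have s: "?s k y \<in> Pcls E (?s k z) \<and> ?s (-k) (?s k y) = y"
        if "z \<in> carrier E" "y \<in> Pcls E z" for k y z
        using that mem_P_iff[of z y] mem_P_iff[of "?s k z" "?s k y"] P_nakayama[of y z k] by auto
      have "?s (-n) (?s n (tgt w)) = tgt w" using r(1) by simp
      then show ?thesis
        using s[of "tgt w" _ n] s[of "?s n (tgt w)" _ "-n"] r(1)
        by (intro bij_betw_byWitness[where f' = "?s (-n)"]) auto
    qed
    ultimately have "bij_betw (?s n \<circ> (tgt \<circ> fst)) (?S \<times> {n}) (Pcls E (?s n (tgt w)))"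
      by (meson bij_betw_trans)
    moreover have "(?s n \<circ> (tgt \<circ> fst)) v = ZB_proj E v" if "v \<in> ?S \<times> {n}" for v
      using that by (auto simp: ZB_proj_def)
    ultimately have "bij_betw (ZB_proj E) (?S \<times> {n}) (Pcls E (?s n (tgt w)))"
      using bij_betw_cong by blast
    then show ?thesis using ZB_P[OF w] x by (simp add: ZB_proj_def)
  qed
  have L: "Lcls ?Z x = {x}" "Lcls E (ZB_proj E x) = {ZB_proj E x}" if "x \<in> carrier ?Z" for x
    using Z.type_MS[OF that] type_MS ZB_proj_closed that by auto
  have fE: "fBC E" "fBC ?Z" by unfold_locales
  show ?thesis
    unfolding fbc_covering_def fbc_morphism_def
    using fE P L ZB_proj_closed[of _ e] ZB_proj_act[of _ e] deg_ZB_proj[of _ e]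
    by (auto simp: bij_betw_def)
qed

section \<open>The universal cover\<close>

context fBC
begin

lemma carrier_ucov [simp]: "carrier (ucov E e) = ucov_set E e"
  by (simp add: ucov_def)

lemma hclass_in_ucov: "\<lbrakk>is_walk E w; src w = e\<rbrakk> \<Longrightarrow> hclass E w \<in> ucov_set E e"
  by (auto simp: ucov_set_def)

lemma ucov_setE:
  assumes "C \<in> ucov_set E e"
  obtains w where "is_walk E w" "src w = e" "C = hclass E w"
  using assms by (auto simp: ucov_set_def)

lemma act_ucov:
  assumes "is_walk E w" "src w = e"
  shows "act (ucov E e) n (hclass E w) = hclass E (act_walk n w)"
proof -
  have "hclass E (pow_walk E n (tgt v) \<cdot>\<^sub>w v) = hclass E (act_walk n w)" if "v \<in> hclass E w" for v
  proof -
    have "homotopic E w v" using that by (simp add: hclass_def)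
    then have "homotopic E (act_walk n w) (act_walk n v)" by (rule act_walk_cong)
    then have "hclass E (act_walk n w) = hclass E (act_walk n v)" using hclass_eq_iff assms by simp
    then show ?thesis by (simp add: act_walk_def)
  qed
  moreover have "w \<in> hclass E w" using assms by (simp add: hclass_def homotopic.refl)
  ultimately have "(\<Union>v\<in>hclass E w. hclass E (pow_walk E n (tgt v) \<cdot>\<^sub>w v)) = hclass E (act_walk n w)"
    by auto
  then show ?thesis using hclass_in_ucov[OF assms] by (simp add: ucov_def)
qed

lemma action_ucov: "group_action integer_group (ucov_set E e) (act (ucov E e))"
proof (rule int_group_actionI)
  show "act (ucov E e) n \<in> extensional (ucov_set E e)" for n
    by (simp add: ucov_def)
  fix C assume "C \<in> ucov_set E e"
  then obtain w where w: "is_walk E w" "src w = e" "C = hclass E w" by (rule ucov_setE)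
  show "act (ucov E e) n C \<in> ucov_set E e" for n
    using w by (simp add: act_ucov hclass_in_ucov)
  show "act (ucov E e) 0 C = C" using w by (simp add: act_ucov)
  show "act (ucov E e) (m + n) C = act (ucov E e) m (act (ucov E e) n C)" for m n
    using w hclass_eq_iff[of "act_walk m (act_walk n w)" "act_walk (m + n) w"]
      act_walk_act_walk[of w m n] by (simp add: act_ucov)
qed

text \<open>A general K serves both partitions; its inclusion in P makes the appended tau steps
  legal.\<close>

lemma tau_classes_hclass:
  assumes "is_walk E w" "\<And>x. x \<in> carrier E \<Longrightarrow> K x \<subseteq> Pcls E x"
  shows "tau_classes E K (hclass E w) = {hclass E (Step h Tau w) | h. h \<in> K (tgt w)}"
proof -
  have *: "hclass E (Step h Tau v) = hclass E (Step h Tau w)" "tgt v = tgt w"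
    if "v \<in> hclass E w" "h \<in> K (tgt v)" for v h
  proof -
    have h: "homotopic E w v" using that by (simp add: hclass_def)
    show t: "tgt v = tgt w" using homotopic_ends[OF h] by simp
    have "h \<in> Pcls E (tgt w)" using assms that t walk_tgt by fastforce
    then have "h \<in> carrier E" "Pcls E h = Pcls E (tgt w)"
      using mem_P_iff[of "tgt w" h] assms by auto
    then show "hclass E (Step h Tau v) = hclass E (Step h Tau w)"
      using homotopic_Step[OF h, of h Tau] hclass_eq_iff[of "Step h Tau w" "Step h Tau v"] assms by simp
  qed
  have w: "w \<in> hclass E w" using assms by (simp add: hclass_def homotopic.refl)
  show ?thesis
  proof (intro equalityI subsetI)
    fix D assume "D \<in> tau_classes E K (hclass E w)"
    then obtain h v where v: "v \<in> hclass E w" "h \<in> K (tgt v)" and D: "D = hclass E (Step h Tau v)"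
      unfolding tau_classes_def by blast
    show "D \<in> {hclass E (Step h Tau w) | h. h \<in> K (tgt w)}" using D v * by auto
  qed (use w in \<open>auto simp: tau_classes_def\<close>)
qed

lemma class_in_tau_classes:
  assumes "C \<in> ucov_set E e"
  shows "C \<in> tau_classes E (Pcls E) C"
proof -
  obtain w where w: "is_walk E w" "src w = e" "C = hclass E w" using assms by (rule ucov_setE)
  have "hclass E (Step (tgt w) Tau w) = hclass E w"
    using hclass_eq_iff[of "Step (tgt w) Tau w" w] homotopic_tau[OF w(1)] w by simp
  then show ?thesis using tau_classes_hclass[of w "Pcls E"] w P_self[of "tgt w"] by auto
qed

section \<open>Walks representing the points of the universal cover\<close>

definition ZB_walk :: "'a walk \<times> int \<Rightarrow> 'a walk" where
  "ZB_walk = (\<lambda>(w, n). act_walk (n * int (deg E (tgt w))) w)"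

lemma ZB_walk_ends:
  assumes "x \<in> B_set E e \<times> UNIV"
  shows "is_walk E (ZB_walk x) \<and> src (ZB_walk x) = e \<and> tgt (ZB_walk x) = ZB_proj E x"
  using assms reduced_is_walk by (auto simp: ZB_walk_def ZB_proj_def B_set_eq)

text \<open>At the wrap-around w = g^l r with r the reset walk and d = 1 + l, so the full turn
  gained by the integer equals what resetting removes plus the one new step.\<close>

lemma ZB_walk_step:
  assumes "reduced E w"
  shows "homotopic E (ZB_walk (ZB_step (w, n))) (act_walk 1 (ZB_walk (w, n)))"
proof -
  let ?d = "int (deg E (tgt w))"
  have w: "is_walk E w" using reduced_is_walk[OF assms] .
  have m: "homotopic E (act_walk (1 + n * ?d) w) (act_walk 1 (ZB_walk (w, n)))"
    using homotopic.sym[OF act_walk_act_walk[OF w, of 1 "n * ?d"]] by (simp add: ZB_walk_def)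
  show ?thesis
  proof (cases "last_exp w < deg E (tgt w) - 1")
    case True
    then have "ZB_walk (ZB_step (w, n)) = act_walk (n * ?d) (Step (act E 1 (tgt w)) Gen w)"
      using assms by (simp add: ZB_walk_def ZB_step_def B_gen_def)
    also have "homotopic E \<dots> (act_walk (n * ?d) (act_walk 1 w))" by (rule act_walk_cong[OF Gen_act_walk[OF w]])
    also have "homotopic E \<dots> (act_walk (n * ?d + 1) w)" by (rule act_walk_act_walk[OF w])
    finally show ?thesis using m by (simp add: add.commute homotopic.trans)
  next
    case False
    let ?r = "reset_exp w"
    have l: "?d = 1 + int (last_exp w)" using False last_exp_less[OF assms] by simp
    have r: "reduced E ?r" "act_walk (int (last_exp w)) ?r = w" using act_walk_reset[OF assms] by auto
    have d: "deg E (tgt ?r) = deg E (tgt w)" using tgt_eq_reset[OF assms] r(1) by simp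
    have "ZB_walk (ZB_step (w, n)) = act_walk ((n + 1) * ?d) ?r"
      using False by (simp add: ZB_walk_def ZB_step_def B_gen_def d)
    also have "(n + 1) * ?d = (1 + n * ?d) + int (last_exp w)" using l by (simp add: algebra_simps)
    also have "homotopic E (act_walk \<dots> ?r) (act_walk (1 + n * ?d) w)"
      using homotopic.sym[OF act_walk_act_walk[OF reduced_is_walk[OF r(1)], of "1 + n * ?d" "int (last_exp w)"]] r(2)
      by simp
    also note m
    finally show ?thesis .
  qed
qed

text \<open>Two walks in one class differ by tau steps from a common stem, which (h2) merges into
  one; \<open>act_walk_tau\<close> then moves that step past the full turns.\<close>

lemma ZB_walk_tau:
  assumes "x \<in> B_set E e \<times> UNIV" "y \<in> Pcls (ZB_conf E e) x"
  shows "homotopic E (ZB_walk y) (Step (ZB_proj E y) Tau (ZB_walk x))"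
proof -
  obtain w v n where x: "x = (w, n)" and y: "y = (v, n)" and s: "stem v = stem w"
    and r: "reduced E w" "reduced E v"
    using assms ZB_P by (cases x; cases y) (auto simp: B_set_eq)
  let ?s = "stem w"
  have w: "is_walk E w" "is_walk E v" using r reduced_is_walk by auto
  have S: "reduced E ?s" "is_walk E ?s" "Pcls E (tgt ?s) = Pcls E (tgt w)" "Pcls E (tgt ?s) = Pcls E (tgt v)"
    using reduced_stem[OF r(1)] reduced_stem[OF r(2)] reduced_is_walk s by auto
  \<comment> \<open>Either u ends in tau and this is an equality, or u is its own stem and a trivial
    tau step is inserted by (h1).\<close>
  have *: "homotopic E u (Step (tgt u) Tau (stem u))" if "reduced E u" for u
    using that reduced_is_walk[OF that] homotopic.sym[OF homotopic_tau[of u]] homotopic.refl[of E u]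
    by (cases u) (auto split: letter.splits)
  have "homotopic E v (Step (tgt v) Tau ?s)" using *[OF r(2)] s by simp
  also have "homotopic E \<dots> (Step (tgt v) Tau (Step (tgt w) Tau ?s))"
    using homotopic.sym[OF homotopic_tau_tau[OF S(2), of "tgt w" "tgt v"]] S w by simp
  also have "homotopic E \<dots> (Step (tgt v) Tau w)"
    using homotopic_Step[OF homotopic.sym[OF *[OF r(1)]], of "tgt v" Tau] S w by simp
  finally have "homotopic E (ZB_walk y) (act_walk (n * int (deg E (tgt v))) (Step (tgt v) Tau w))"
    unfolding ZB_walk_def y using act_walk_cong by simp
  also have "homotopic E \<dots> (Step (ZB_proj E y) Tau (ZB_walk x))"
    using homotopic.sym[OF act_walk_tau[OF w(1), of "tgt v" n]] S w by (simp add: ZB_walk_def ZB_proj_def x y)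
  finally show ?thesis .
qed

end

context fms_BC
begin

section \<open>Lifts to ZB\<close>

lemma covering_map_ZB: "covering_map (ZB_conf E e) E (ZB_proj E)"
  using covering_ZB[of e] fms_BC.axioms(1)[OF fms_BC_ZB[of e]] fBC_axioms
  by (simp add: covering_map_def covering_map_axioms_def)

text \<open>Every initial part of w is itself a point of B: below the degree a \<open>Gen\<close>
  step is the action without wrap-around, and a tau step stays in the P'-class.\<close>

lemma lift_reduced:
  assumes "reduced E w" "src w = e"
  shows "lift (ZB_conf E e) (ZB_proj E) (Triv e, 0) w = (w, 0)"
  using assms
proof (induction w)
  case (Step y \<delta> w)
  interpret q: covering_map "ZB_conf E e" E "ZB_proj E" by (rule covering_map_ZB)
  have w: "w \<in> B_set E e" and yw: "Step y \<delta> w \<in> B_set E e" using Step.prems by (auto simp: B_set_eq)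
  have IH: "lift (ZB_conf E e) (ZB_proj E) (Triv e, 0) w = (w, 0)" using Step by simp
  consider "\<delta> = Gen" | "\<delta> = Tau" using Step.prems by (cases \<delta>) auto
  then show ?case
  proof cases
    case 1
    then show ?thesis using Step.prems IH act_ZB_1[of "(w, 0)" e] w by (auto simp: ZB_step_def B_gen_def)
  next
    case 2
    have "(Step y Tau w, 0) \<in> Pcls (ZB_conf E e) (w, 0)"
      using Step.prems 2 ZB_P[OF w] w yw by (simp add: B_set_eq)
    from q.the_tau[OF _ this] show ?thesis
      using IH 2 w Step.prems by (simp add: ZB_proj_def)
  qed
qed auto

lemma lift_ZB_walk:
  assumes "x \<in> B_set E e \<times> UNIV"
  shows "lift (ZB_conf E e) (ZB_proj E) (Triv e, 0) (ZB_walk x) = x"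
proof -
  interpret q: covering_map "ZB_conf E e" E "ZB_proj E" by (rule covering_map_ZB)
  obtain w n where x: "x = (w, n)" "w \<in> B_set E e" using assms by auto
  then have "lift (ZB_conf E e) (ZB_proj E) (Triv e, 0) w = (w, 0)"
    using lift_reduced by (simp add: B_set_eq)
  then show ?thesis
    using x act_ZB_deg[OF x(2), of n 0] q.lift_pow[of "(w, 0)"]
    by (simp add: ZB_walk_def act_walk_def lift_comp)
qed

text \<open>A map over \<open>E\<close> is determined by its value at the base point because it respects lifts.\<close>

lemma map_lift:
  assumes e: "e \<in> carrier E" and base: "\<phi> (Triv e, 0) = hclass E (Triv e)"
    and act: "\<And>n x. x \<in> B_set E e \<times> UNIV \<Longrightarrow> \<phi> (act (ZB_conf E e) n x) = act (ucov E e) n (\<phi> x)"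
    and P: "\<And>x y. x \<in> B_set E e \<times> UNIV \<Longrightarrow> y \<in> Pcls (ZB_conf E e) x \<Longrightarrow> \<phi> y \<in> tau_classes E (Pcls E) (\<phi> x)"
    and proj: "\<And>x. x \<in> B_set E e \<times> UNIV \<Longrightarrow> class_tgt (\<phi> x) = ZB_proj E x"
    and v: "is_walk E v" "src v = e"
  shows "\<phi> (lift (ZB_conf E e) (ZB_proj E) (Triv e, 0) v) = hclass E v"
  using v
proof (induction v)
  case (Step y \<delta> v)
  interpret q: covering_map "ZB_conf E e" E "ZB_proj E" by (rule covering_map_ZB)
  let ?l = "lift (ZB_conf E e) (ZB_proj E) (Triv e, 0)"
  have v: "is_walk E v" "src v = e" using Step.prems by auto
  have IH: "\<phi> (?l v) = hclass E v" using Step by simp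
  have z: "(Triv e, 0) \<in> B_set E e \<times> UNIV" "ZB_proj E (Triv e, 0) = e"
    using e by (auto simp: B_set_eq ZB_proj_def)
  have l: "?l v \<in> B_set E e \<times> UNIV" "ZB_proj E (?l v) = tgt v"
    using q.lift_closed[OF v(1), of "(Triv e, 0)"] z v by auto
  show ?case
  proof (cases \<delta>)
    case Gen
    then have "homotopic E (Step y \<delta> v) (act_walk 1 v)" using Gen_act_walk[OF v(1)] Step.prems by simp
    then show ?thesis
      using act[OF l(1), of 1] IH v act_ucov[OF v, of 1] hclass_eq_iff[of "Step y \<delta> v" "act_walk 1 v"] Step.prems Gen
      by simp
  next
    case GenInv
    then have "homotopic E (Step y \<delta> v) (act_walk (-1) v)"
      using Step.prems homotopic.refl[of E "Step y \<delta> v"] by (simp add: act_walk_def pow_walk_def)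
    then show ?thesis
      using act[OF l(1), of "-1"] IH v act_ucov[OF v, of "-1"]
        hclass_eq_iff[of "Step y \<delta> v" "act_walk (-1) v"] Step.prems GenInv
      by simp
  next
    case Tau
    then have "y \<in> Pcls E (ZB_proj E (?l v))" using Step.prems l mem_P_iff[of "tgt v"] by simp
    with l(1)[folded carrier_ZB] obtain u where u: "u \<in> Pcls (ZB_conf E e) (?l v)" "u \<in> carrier (ZB_conf E e)"
       "Pcls (ZB_conf E e) u = Pcls (ZB_conf E e) (?l v)" "ZB_proj E u = y"
       "(THE u. u \<in> Pcls (ZB_conf E e) (?l v) \<and> ZB_proj E u = y) = u"
      by (rule q.ex_tau)
    have "\<phi> u \<in> tau_classes E (Pcls E) (hclass E v)" using P[OF l(1) u(1)] IH by simp
    then obtain h where h: "\<phi> u = hclass E (Step h Tau v)" "h \<in> Pcls E (tgt v)"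
      using tau_classes_hclass[OF v(1), of "Pcls E"] by auto
    then have "is_walk E (Step h Tau v)" using v mem_P_iff[of "tgt v" h] by simp
    \<comment> \<open>Membership in the tau class only gives some end point h; compatibility with
      the projections identifies it.\<close>
    then have "h = y" using proj[of u] u h by simp
    then show ?thesis using h Tau u by simp
  qed
qed (use base in simp)

section \<open>The isomorphism and its uniqueness\<close>

context
  fixes e assumes e: "e \<in> carrier E"
begin

definition phi :: "'a walk \<times> int \<Rightarrow> 'a walk set" where
  "phi = (\<lambda>x\<in>B_set E e \<times> UNIV. hclass E (ZB_walk x))"

lemma phi_eq: "x \<in> B_set E e \<times> UNIV \<Longrightarrow> phi x = hclass E (ZB_walk x)"
  by (simp add: phi_def)

lemma phi_in: "x \<in> B_set E e \<times> UNIV \<Longrightarrow> phi x \<in> ucov_set E e"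
  using ZB_walk_ends[of x e] hclass_in_ucov[of "ZB_walk x" e] phi_eq by simp

lemma phi_tgt: "x \<in> B_set E e \<times> UNIV \<Longrightarrow> class_tgt (phi x) = ZB_proj E x"
  using ZB_walk_ends[of x e] phi_eq by simp

lemma phi_base: "phi (Triv e, 0) = hclass E (Triv e)"
  using e by (simp add: phi_def B_set_eq ZB_walk_def)

lemma phi_act:
  assumes "x \<in> B_set E e \<times> UNIV"
  shows "phi (act (ZB_conf E e) n x) = act (ucov E e) n (phi x)"
proof (rule int_action_equivariant[OF action_ZB action_ucov phi_in _ assms])
  fix x :: "'a walk \<times> int" assume x: "x \<in> B_set E e \<times> UNIV"
  have g: "ZB_step x \<in> B_set E e \<times> UNIV" using int_action_closed[OF action_ZB x, of 1] act_ZB_1[OF x] by simp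
  have "homotopic E (ZB_walk (ZB_step x)) (act_walk 1 (ZB_walk x))"
    using ZB_walk_step x by (auto simp: B_set_eq)
  then show "phi (act (ZB_conf E e) 1 x) = act (ucov E e) 1 (phi x)"
    using phi_eq[OF x] phi_eq[OF g] act_ZB_1[OF x] ZB_walk_ends[OF x] ZB_walk_ends[OF g] act_ucov hclass_eq_iff
    by simp
qed

text \<open>\<open>ZB_walk_tau\<close> computes the images, and they exhaust the tau class because q
  maps each P-class onto the one below.\<close>

lemma phi_P:
  assumes x: "x \<in> B_set E e \<times> UNIV"
  shows "phi ` Pcls (ZB_conf E e) x = tau_classes E (Pcls E) (phi x)"
proof -
  interpret q: covering_map "ZB_conf E e" E "ZB_proj E" by (rule covering_map_ZB)
  have xc: "x \<in> carrier (ZB_conf E e)" using x by simp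
  have w: "is_walk E (ZB_walk x)" "tgt (ZB_walk x) = ZB_proj E x" using ZB_walk_ends[OF x] by auto
  have *: "phi y = hclass E (Step (ZB_proj E y) Tau (ZB_walk x))" if "y \<in> Pcls (ZB_conf E e) x" for y
  proof -
    have y: "y \<in> B_set E e \<times> UNIV" using that q.X.mem_P_iff[OF xc] by simp
    show ?thesis
      using ZB_walk_tau[OF x that] hclass_eq_iff ZB_walk_ends[OF y] phi_eq[OF y] by simp
  qed
  have "tau_classes E (Pcls E) (phi x) = (\<lambda>h. hclass E (Step h Tau (ZB_walk x))) ` Pcls E (ZB_proj E x)"
    using tau_classes_hclass[OF w(1), of "Pcls E"] phi_eq[OF x] w by auto
  also have "Pcls E (ZB_proj E x) = ZB_proj E ` Pcls (ZB_conf E e) x"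
    using q.q_P[OF xc] by (simp add: bij_betw_def)
  finally show ?thesis using * by (auto simp: image_image)
qed

lemma phi_bij: "bij_betw phi (B_set E e \<times> UNIV) (ucov_set E e)"
proof -
  interpret q: covering_map "ZB_conf E e" E "ZB_proj E" by (rule covering_map_ZB)
  have z: "(Triv e, 0) \<in> carrier (ZB_conf E e)" "ZB_proj E (Triv e, 0) = e"
    using e by (auto simp: B_set_eq ZB_proj_def)
  have inj: "x = y" if "x \<in> B_set E e \<times> UNIV" "y \<in> B_set E e \<times> UNIV" "phi x = phi y" for x y
  proof -
    have "homotopic E (ZB_walk x) (ZB_walk y)"
      using that phi_eq hclass_eq_iff[of "ZB_walk x" "ZB_walk y"] ZB_walk_ends[of x e] by simp
    then show ?thesis
      using q.lift_homotopic[OF _ z(1)] z(2) lift_ZB_walk that ZB_walk_ends by metis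
  qed
  have surj: "C \<in> phi ` (B_set E e \<times> UNIV)" if C: "C \<in> ucov_set E e" for C
  proof -
    obtain v where v: "is_walk E v" "src v = e" "C = hclass E v" using C by (rule ucov_setE)
    \<comment> \<open>The preimage of the class of v is the end point of the lift of v.\<close>
    have "phi (lift (ZB_conf E e) (ZB_proj E) (Triv e, 0) v) = hclass E v"
    proof (rule map_lift[OF e phi_base phi_act _ phi_tgt v(1,2)])
      fix x y assume "x \<in> B_set E e \<times> UNIV" "y \<in> Pcls (ZB_conf E e) x"
      then show "phi y \<in> tau_classes E (Pcls E) (phi x)" using phi_P[of x] by blast
    qed
    moreover have "lift (ZB_conf E e) (ZB_proj E) (Triv e, 0) v \<in> B_set E e \<times> UNIV"
      using q.lift_closed[OF v(1) z(1)] z v by simp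
    ultimately show ?thesis using v(3) by (metis imageI)
  qed
  show ?thesis
    unfolding bij_betw_def using inj surj phi_in by (auto intro!: inj_onI)
qed

lemma deg_ucov: "deg (ucov E e) C = deg E (class_tgt C)"
  by (simp add: ucov_def)

lemma ucov_partition: "partition_on (ucov_set E e) (Ppart (ucov E e))"
proof -
  interpret Z: fms_BC "ZB_conf E e" by (rule fms_BC_ZB)
  have "Ppart (ucov E e) = tau_classes E (Pcls E) ` phi ` (B_set E e \<times> UNIV)"
    using phi_bij by (simp add: ucov_def bij_betw_def)
  also have "\<dots> = (`) phi ` Ppart (ZB_conf E e)"
    by (subst Z.Ppart_eq) (simp add: image_image phi_P)
  \<comment> \<open>No block is empty; removing the empty set matches the form of
    \<open>partition_on_inj_image\<close>.\<close>
  also have "\<dots> = (`) phi ` Ppart (ZB_conf E e) - {{}}"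
    using partition_onD3[OF Z.P_partition] by auto
  finally show ?thesis
    using partition_on_inj_image[OF Z.P_partition, of phi] phi_bij by (simp add: bij_betw_def)
qed

lemma ucov_P:
  assumes "C \<in> ucov_set E e" shows "Pcls (ucov E e) C = tau_classes E (Pcls E) C"
  using assms class_in_tau_classes[OF assms]
  by (intro block_of_eq[OF ucov_partition]) (auto simp: ucov_def)

lemma fms_BC_ucov: "fms_BC (ucov E e)"
proof (rule fms_BC_intro)
  let ?U = "ucov E e" and ?Z = "ZB_conf E e"
  interpret Z: fms_BC ?Z by (rule fms_BC_ZB)
  show "group_action integer_group (carrier ?U) (act ?U)" using action_ucov by simp
  show "partition_on (carrier ?U) (Ppart ?U)" using ucov_partition by simp
  have "tau_classes E (Lcls E) C = {C}" if C: "C \<in> ucov_set E e" for C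
  proof -
    obtain w where w: "is_walk E w" "src w = e" "C = hclass E w" using C by (rule ucov_setE)
    then show ?thesis
      using tau_classes_hclass[OF w(1), of "Lcls E"] f1 type_MS[of "tgt w"] homotopic_tau[OF w(1)]
        hclass_eq_iff[of "Step (tgt w) Tau w" w] by auto
  qed
  then show "Lpart ?U = (\<lambda>x. {x}) ` carrier ?U" by (simp add: ucov_def)
  have phi: "\<exists>x\<in>carrier ?Z. C = phi x" if "C \<in> carrier ?U" for C
    using phi_bij that unfolding bij_betw_def carrier_ZB carrier_ucov by blast
  have P: "Pcls ?U (phi x) = phi ` Pcls ?Z x" if "x \<in> carrier ?Z" for x
    using that phi_P ucov_P phi_in by simp
  have d: "deg ?U (phi x) = deg ?Z x" if "x \<in> carrier ?Z" for x
    using that deg_ZB_proj[of x e] phi_tgt by (simp add: deg_ucov)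
  have a: "act ?U n (phi x) = phi (act ?Z n x)" if "x \<in> carrier ?Z" for n x
    using that phi_act by simp
  fix C assume "C \<in> carrier ?U"
  then obtain x where x: "x \<in> carrier ?Z" "C = phi x" using phi by blast
  show "finite (Pcls ?U C)" using x P Z.f1 by simp
  show "deg ?U C > 0" using x d Z.deg_pos by simp
  show "deg ?U (act ?U n C) = deg ?U C" for n
    using x d a[OF x(1), of n] d[OF Z.act_closed[OF x(1), of n]] Z.deg_act[OF x(1), of n] by simp
  fix D assume "D \<in> carrier ?U"
  then obtain y where y: "y \<in> carrier ?Z" "D = phi y" using phi by blast
  \<comment> \<open>Injectivity turns equality of image classes into equality of classes in ZB, so
    (f4) is inherited from there.\<close>
  have inj: "phi ` Pcls ?Z u = phi ` Pcls ?Z v \<longleftrightarrow> Pcls ?Z u = Pcls ?Z v"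
    if "u \<in> carrier ?Z" "v \<in> carrier ?Z" for u v
  proof (rule inj_on_image_eq_iff)
    show "inj_on phi (carrier ?Z)" using phi_bij by (simp add: bij_betw_def)
    show "Pcls ?Z u \<subseteq> carrier ?Z" "Pcls ?Z v \<subseteq> carrier ?Z"
      using that Z.mem_P_iff by blast+
  qed
  show "Pcls ?U C = Pcls ?U D \<longleftrightarrow>
     Pcls ?U (act ?U (int (deg ?U C)) C) = Pcls ?U (act ?U (int (deg ?U D)) D)"
    unfolding x(2) y(2) d[OF x(1)] d[OF y(1)] a[OF x(1)] a[OF y(1)]
      P[OF x(1)] P[OF y(1)] P[OF Z.act_closed[OF x(1)]] P[OF Z.act_closed[OF y(1)]]
      inj[OF x(1) y(1)] inj[OF Z.act_closed[OF x(1)] Z.act_closed[OF y(1)]]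
    by (rule Z.f4[OF x(1) y(1)])
qed

lemma phi_iso: "fbc_iso (ZB_conf E e) (ucov E e) phi"
proof -
  let ?U = "ucov E e" and ?Z = "ZB_conf E e"
  interpret Z: fms_BC ?Z by (rule fms_BC_ZB)
  interpret U: fms_BC ?U by (rule fms_BC_ucov)
  show ?thesis
  proof (rule fbc_isoI)
    show "fBC ?Z" "fBC ?U" by unfold_locales
    show "bij_betw phi (carrier ?Z) (carrier ?U)" using phi_bij by simp
    fix x assume x: "x \<in> carrier ?Z"
    show "phi (act ?Z n x) = act ?U n (phi x)" for n using x phi_act by simp
    show "phi ` Pcls ?Z x = Pcls ?U (phi x)" using x phi_P ucov_P phi_in by simp
    show "phi ` Lcls ?Z x = Lcls ?U (phi x)" using x Z.type_MS U.type_MS phi_in by simp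
    show "deg ?U (phi x) = deg ?Z x"
      using x deg_ZB_proj[of x e] phi_tgt by (simp add: deg_ucov)
  qed
qed

text \<open>Each x is the end point of the lift of \<open>ZB_walk x\<close>, so
  \<open>map_lift\<close> evaluates \<open>\<psi>\<close> at x; extensionality settles the values
  off the carrier.\<close>

lemma phi_unique:
  assumes ext: "\<psi> \<in> extensional (carrier (ZB_conf E e))"
    and mor: "fbc_morphism (ZB_conf E e) (ucov E e) \<psi>"
    and proj: "\<And>x. x \<in> carrier (ZB_conf E e) \<Longrightarrow> ZB_proj E x = ucov_proj (\<psi> x)"
    and base: "\<psi> (Triv e, 0) = hclass E (Triv e)"
  shows "\<psi> = phi"
proof (rule extensionalityI[OF ext])
  show "phi \<in> extensional (carrier (ZB_conf E e))" by (simp add: phi_def)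
  fix x assume "x \<in> carrier (ZB_conf E e)"
  then have x: "x \<in> B_set E e \<times> UNIV" by simp
  have m: "\<psi> (act (ZB_conf E e) n y) = act (ucov E e) n (\<psi> y)"
      "\<psi> ` Pcls (ZB_conf E e) y \<subseteq> Pcls (ucov E e) (\<psi> y)" "\<psi> y \<in> ucov_set E e"
      "class_tgt (\<psi> y) = ZB_proj E y"
    if "y \<in> B_set E e \<times> UNIV" for n y
    using that mor proj[of y] unfolding fbc_morphism_def carrier_ZB carrier_ucov ucov_proj_def
    by (blast, blast, blast, simp)
  have "\<psi> (lift (ZB_conf E e) (ZB_proj E) (Triv e, 0) (ZB_walk x)) = hclass E (ZB_walk x)"
  proof (rule map_lift[where \<phi> = \<psi>, OF e base m(1) _ m(4)])
    fix y u assume y: "y \<in> B_set E e \<times> UNIV" and "u \<in> Pcls (ZB_conf E e) y"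
    then show "\<psi> u \<in> tau_classes E (Pcls E) (\<psi> y)"
      using m(2)[OF y] ucov_P[OF m(3)[OF y]] by blast
  qed (use ZB_walk_ends[OF x] in auto)
  then show "\<psi> x = phi x" using lift_ZB_walk[OF x] phi_eq[OF x] by simp
qed

end

end

theorem corollary1p4:
  fixes E :: "'a fbc" and e :: 'a
  assumes "fms_BC E" and "e \<in> carrier E"
  shows "fbc_covering (ZB_conf E e) E (ZB_proj E) \<and>
         (\<exists>!\<phi>. \<phi> \<in> extensional (carrier (ZB_conf E e)) \<and>
           fbc_iso (ZB_conf E e) (ucov E e) \<phi> \<and>
           (\<forall>x\<in>carrier (ZB_conf E e). ZB_proj E x = ucov_proj (\<phi> x)) \<and>
           \<phi> (Triv e, 0) = hclass E (Triv e))"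
proof -
  interpret fms_BC E by fact
  note e = assms(2)
  show ?thesis
  proof (intro conjI ex1I[where a = "phi e"])
    show "fbc_covering (ZB_conf E e) E (ZB_proj E)" by (rule covering_ZB)
    show "phi e \<in> extensional (carrier (ZB_conf E e))" by (simp add: phi_def e)
    show "fbc_iso (ZB_conf E e) (ucov E e) (phi e)" by (rule phi_iso[OF e])
    show "\<forall>x\<in>carrier (ZB_conf E e). ZB_proj E x = ucov_proj (phi e x)"
      using phi_tgt[OF e] by (simp add: ucov_proj_def)
    show "phi e (Triv e, 0) = hclass E (Triv e)" by (rule phi_base[OF e])
  next
    fix \<psi>
    assume "\<psi> \<in> extensional (carrier (ZB_conf E e)) \<and> fbc_iso (ZB_conf E e) (ucov E e) \<psi> \<and>
      (\<forall>x\<in>carrier (ZB_conf E e). ZB_proj E x = ucov_proj (\<psi> x)) \<and> \<psi> (Triv e, 0) = hclass E (Triv e)"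
    then show "\<psi> = phi e"
      unfolding fbc_iso_def by (intro phi_unique[OF e]) auto
  qed
qed

end
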